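(* Let $N\ge1$ be an odd integer, $n\ge2$ an integer, and let $\boldsymbol{k}$ be a field whose characteristic does not divide $2nN$ and which contains a primitive $4nN$-th root of unity. If $n$ is even, then the Hopf algebra $A_{Nn}^{++}$ is not self-dual.
   Context: For $N\ge 1$, $n\ge 2$ and $\nu,\lambda=\pm1$, Suzuki's Hopf algebra $A_{Nn}^{\nu\lambda}$ is the $\boldsymbol{k}$-algebra generated by $x_{11},x_{12},x_{21},x_{22}$ with relations $x_{11}^2=x_{22}^2$, $x_{12}^2=x_{21}^2$, $x_{ij}x_{lm}=0$ whenever $i-j\not\equiv l-m\pmod 2$, $x_{11}^{2N}+\nu x_{12}^{2N}=1$, $\underbrace{x_{11}x_{22}x_{11}\cdots}_{n}=\underbrace{x_{22}x_{11}x_{22}\cdots}_{n}$, $\underbrace{x_{21}x_{12}x_{21}\cdots}_{n}=\lambda\underbrace{x_{12}x_{21}x_{12}\cdots}_{n}$ (alternating words of length $n$), with $\Delta(x_{ij})=x_{i1}\otimes x_{1j}+x_{i2}\otimes x_{2j}$, $\varepsilon(x_{ij})=\delta_{ij}$, $S(x_{ij})=x_{ji}^{2N-1}$. It has dimension $4nN$. $A_{Nn}^{++}$ means $\nu=\lambda=1$. A finite-dimensional Hopf algebra $A$ is self-dual if $A$ is isomorphic to the dual Hopf algebra $A^\ast$ as a Hopf algebra. *)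

theory Defs
  imports
    "HOL.Modules"
    "HOL-Algebra.QuotRing"
    "HOL-Algebra.Module"
    "HOL-Library.Poly_Mapping"
begin

text \<open>
  The ground field is a type \<open>'k\<close> of class \<^class>\<open>field\<close>.  Algebras over it are
  records of the \<open>module\<close> type of HOL-Algebra (a ring together with a scalar
  multiplication), so that carriers may depend on the parameters of the presentation.
\<close>

definition primitive_root_of_unity :: "nat \<Rightarrow> 'k::field \<Rightarrow> bool" where
  "primitive_root_of_unity m z \<longleftrightarrow> 0 < m \<and> z ^ m = 1 \<and> (\<forall>k. 0 < k \<and> k < m \<longrightarrow> z ^ k \<noteq> 1)"

definition scalars :: "('k::field, 'k) module" where
  "scalars = \<lparr>carrier = UNIV, monoid.mult = (*), one = 1, ring.zero = 0, add = (+), module.smult = (*)\<rparr>"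

definition opposite :: "('k, 'a, 'z) module_scheme \<Rightarrow> ('k, 'a, 'z) module_scheme" where
  "opposite A = A\<lparr>monoid.mult := (\<lambda>x y. y \<otimes>\<^bsub>A\<^esub> x)\<rparr>"


subsection \<open>Monoid algebras, quotients, and maps out of them\<close>

definition scale :: "'k::field \<Rightarrow> ('m \<Rightarrow>\<^sub>0 'k) \<Rightarrow> ('m \<Rightarrow>\<^sub>0 'k)" where
  "scale c f = Poly_Mapping.map ((*) c) f"

definition monoid_algebra :: "('m, 'z) monoid_scheme \<Rightarrow> ('k::field, 'm \<Rightarrow>\<^sub>0 'k) module" where
  "monoid_algebra M =
    \<lparr>carrier = {f. Poly_Mapping.keys f \<subseteq> carrier M},
     monoid.mult = (\<lambda>f g. \<Sum>p\<in>Poly_Mapping.keys f. \<Sum>q\<in>Poly_Mapping.keys g.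
               Poly_Mapping.single (p \<otimes>\<^bsub>M\<^esub> q) (Poly_Mapping.lookup f p * Poly_Mapping.lookup g q)),
     one = Poly_Mapping.single \<one>\<^bsub>M\<^esub> 1,
     ring.zero = 0,
     add = (+),
     module.smult = scale\<rparr>"

definition free_monoid :: "'g set \<Rightarrow> 'g list monoid" where
  "free_monoid X = \<lparr>carrier = lists X, monoid.mult = (@), one = []\<rparr>"

definition free_algebra :: "'g set \<Rightarrow> ('k::field, 'g list \<Rightarrow>\<^sub>0 'k) module" where
  "free_algebra X = monoid_algebra (free_monoid X)"

text \<open>The ring quotient of the library, with the induced scalar multiplication
  \<open>c (f + I) = c f + I\<close>.\<close>

definition quotient_algebra :: "('k, 'a, 'z) module_scheme \<Rightarrow> 'a set \<Rightarrow> ('k, 'a set) module" where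
  "quotient_algebra R I =
    ring.extend (R Quot I) (module.fields (\<lambda>c C. \<Union>f\<in>C. I +>\<^bsub>R\<^esub> (c \<odot>\<^bsub>R\<^esub> f)))"

text \<open>\<open>linear_ext V \<phi>\<close> is the linear extension of \<open>\<phi>\<close> from a basis to formal linear
  combinations.  \<open>induced V \<phi>\<close> is the map that it induces on cosets; it is meaningful when
  \<open>linear_ext V \<phi>\<close> is constant on each coset.\<close>

definition linear_ext ::
    "('k::field, 'v, 'z) module_scheme \<Rightarrow> ('m \<Rightarrow> 'v) \<Rightarrow> ('m \<Rightarrow>\<^sub>0 'k) \<Rightarrow> 'v" where
  "linear_ext V \<phi> f =
    (\<Oplus>\<^bsub>V\<^esub>p\<in>Poly_Mapping.keys f. Poly_Mapping.lookup f p \<odot>\<^bsub>V\<^esub> \<phi> p)"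

definition induced ::
    "('k::field, 'v, 'z) module_scheme \<Rightarrow> ('m \<Rightarrow> 'v) \<Rightarrow> ('m \<Rightarrow>\<^sub>0 'k) set \<Rightarrow> 'v" where
  "induced V \<phi> C = the_elem (linear_ext V \<phi> ` C)"

definition word_value :: "('v, 'z) monoid_scheme \<Rightarrow> ('g \<Rightarrow> 'v) \<Rightarrow> 'g list \<Rightarrow> 'v" where
  "word_value V v w = foldr (\<lambda>g y. v g \<otimes>\<^bsub>V\<^esub> y) w \<one>\<^bsub>V\<^esub>"

text \<open>The algebra homomorphism to \<open>V\<close>, out of an algebra presented by generators and
  relations, that sends each generator \<open>g\<close> to \<open>v g\<close>.\<close>

definition presented_hom ::
    "('k::field, 'v, 'z) module_scheme \<Rightarrow> ('g \<Rightarrow> 'v) \<Rightarrow> ('g list \<Rightarrow>\<^sub>0 'k) set \<Rightarrow> 'v" where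
  "presented_hom V v = induced V (word_value V v)"


subsection \<open>Tensor products\<close>

type_synonym ('k, 'a, 'b) tensor = "('a \<times> 'b \<Rightarrow>\<^sub>0 'k) set"

definition bilinear_relations ::
    "('k::field, 'a, 'y) module_scheme \<Rightarrow> ('k, 'b, 'z) module_scheme \<Rightarrow> ('a \<times> 'b \<Rightarrow>\<^sub>0 'k) set" where
  "bilinear_relations A B =
     {Poly_Mapping.single (a \<oplus>\<^bsub>A\<^esub> a', b) 1 - Poly_Mapping.single (a, b) 1
        - Poly_Mapping.single (a', b) 1
       | a a' b. a \<in> carrier A \<and> a' \<in> carrier A \<and> b \<in> carrier B}
   \<union> {Poly_Mapping.single (a, b \<oplus>\<^bsub>B\<^esub> b') 1 - Poly_Mapping.single (a, b) 1
        - Poly_Mapping.single (a, b') 1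
       | a b b'. a \<in> carrier A \<and> b \<in> carrier B \<and> b' \<in> carrier B}
   \<union> {Poly_Mapping.single (c \<odot>\<^bsub>A\<^esub> a, b) 1 - Poly_Mapping.single (a, b) c
       | c a b. a \<in> carrier A \<and> b \<in> carrier B}
   \<union> {Poly_Mapping.single (a, c \<odot>\<^bsub>B\<^esub> b) 1 - Poly_Mapping.single (a, b) c
       | c a b. a \<in> carrier A \<and> b \<in> carrier B}"

definition tensor_kernel ::
    "('k::field, 'a, 'y) module_scheme \<Rightarrow> ('k, 'b, 'z) module_scheme \<Rightarrow> ('a \<times> 'b \<Rightarrow>\<^sub>0 'k) set" where
  "tensor_kernel A B = Modules.module.span scale (bilinear_relations A B)"

text \<open>The free vector space on \<open>carrier A \<times> carrier B\<close> is taken with the multiplication of the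
  monoid algebra of \<open>A \<times>\<times> B\<close>, which gives \<open>(a \<otimes> b)(a' \<otimes> b') = a a' \<otimes> b b'\<close> on
  the quotient.\<close>

definition tensor ::
    "('k::field, 'a, 'y) module_scheme \<Rightarrow> ('k, 'b, 'z) module_scheme
      \<Rightarrow> ('k, ('k, 'a, 'b) tensor) module" where
  "tensor A B = quotient_algebra (monoid_algebra (A \<times>\<times> B)) (tensor_kernel A B)"

definition pure_tensor ::
    "('k::field, 'a, 'y) module_scheme \<Rightarrow> ('k, 'b, 'z) module_scheme
      \<Rightarrow> 'a \<Rightarrow> 'b \<Rightarrow> ('k, 'a, 'b) tensor" where
  "pure_tensor A B a b =
    tensor_kernel A B +>\<^bsub>monoid_algebra (A \<times>\<times> B)\<^esub> Poly_Mapping.single (a, b) 1"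

text \<open>\<open>f \<otimes> g : A \<otimes> B \<rightarrow> A' \<otimes> B'\<close>, given by the codomains \<open>A'\<close> and \<open>B'\<close>.\<close>

definition tensor_map ::
    "('k::field, 'c, 'y) module_scheme \<Rightarrow> ('k, 'd, 'z) module_scheme
      \<Rightarrow> ('a \<Rightarrow> 'c) \<Rightarrow> ('b \<Rightarrow> 'd) \<Rightarrow> ('k, 'a, 'b) tensor \<Rightarrow> ('k, 'c, 'd) tensor" where
  "tensor_map A' B' f g = induced (tensor A' B') (\<lambda>(a, b). pure_tensor A' B' (f a) (g b))"

text \<open>The linear form \<open>a \<otimes> b \<mapsto> f(a) g(b)\<close>.\<close>

definition tensor_form ::
    "('a \<Rightarrow> 'k) \<Rightarrow> ('b \<Rightarrow> 'k) \<Rightarrow> ('k::field, 'a, 'b) tensor \<Rightarrow> 'k" where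
  "tensor_form f g = induced scalars (\<lambda>(a, b). f a * g b)"


subsection \<open>Hopf algebra structures, isomorphisms and duals\<close>

record (overloaded) ('k, 'a) hopf_algebra = "('k::field, 'a) module" +
  comult :: "'a \<Rightarrow> ('a \<times> 'a \<Rightarrow>\<^sub>0 'k) set"
  counit :: "'a \<Rightarrow> 'k"
  antipode :: "'a \<Rightarrow> 'a"

definition hopf_iso ::
    "('k::field, 'a, 'y) hopf_algebra_scheme \<Rightarrow> ('k, 'b, 'z) hopf_algebra_scheme
      \<Rightarrow> ('a \<Rightarrow> 'b) set" where
  "hopf_iso A B =
    {f \<in> ring_iso A B.
       (\<forall>c. \<forall>x\<in>carrier A. f (c \<odot>\<^bsub>A\<^esub> x) = c \<odot>\<^bsub>B\<^esub> f x)
     \<and> (\<forall>x\<in>carrier A. comult B (f x) = tensor_map B B f f (comult A x))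
     \<and> (\<forall>x\<in>carrier A. counit B (f x) = counit A x)
     \<and> (\<forall>x\<in>carrier A. f (antipode A x) = antipode B (f x))}"

definition linear_forms :: "('k::field, 'a, 'z) module_scheme \<Rightarrow> ('a \<Rightarrow> 'k) set" where
  "linear_forms A =
    {f \<in> carrier A \<rightarrow>\<^sub>E UNIV.
       (\<forall>x\<in>carrier A. \<forall>y\<in>carrier A. f (x \<oplus>\<^bsub>A\<^esub> y) = f x + f y)
     \<and> (\<forall>c. \<forall>x\<in>carrier A. f (c \<odot>\<^bsub>A\<^esub> x) = c * f x)}"

text \<open>The algebra \<open>A\<^sup>*\<close>, with the convolution product \<open>(f g)(x) = (f \<otimes> g)(\<Delta> x)\<close> and
  unit \<open>\<epsilon>\<close>.\<close>

definition dual_algebra ::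
    "('k::field, 'a, 'z) hopf_algebra_scheme \<Rightarrow> ('k, 'a \<Rightarrow> 'k) module" where
  "dual_algebra A =
    \<lparr>carrier = linear_forms A,
     monoid.mult = (\<lambda>f g. \<lambda>x\<in>carrier A. tensor_form f g (comult A x)),
     one = (\<lambda>x\<in>carrier A. counit A x),
     ring.zero = (\<lambda>x\<in>carrier A. 0),
     add = (\<lambda>f g. \<lambda>x\<in>carrier A. f x + g x),
     module.smult = (\<lambda>c f. \<lambda>x\<in>carrier A. c * f x)\<rparr>"

text \<open>The value of an element of \<open>A\<^sup>* \<otimes> A\<^sup>*\<close> at \<open>a \<otimes> b\<close>.\<close>

definition dual_tensor_eval ::
    "('k::field, 'a \<Rightarrow> 'k, 'a \<Rightarrow> 'k) tensor \<Rightarrow> 'a \<Rightarrow> 'a \<Rightarrow> 'k" where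
  "dual_tensor_eval T a b = tensor_form (\<lambda>f. f a) (\<lambda>g. g b) T"

text \<open>The dual of a finite-dimensional Hopf algebra.  The coproduct \<open>\<Delta>(f)\<close> is the element of
  \<open>A\<^sup>* \<otimes> A\<^sup>*\<close> corresponding to \<open>a \<otimes> b \<mapsto> f(a b)\<close> under the canonical map
  \<open>A\<^sup>* \<otimes> A\<^sup>* \<rightarrow> (A \<otimes> A)\<^sup>*\<close>, which is bijective when \<open>A\<close> has finite dimension.\<close>

definition dual_hopf ::
    "('k::field, 'a, 'z) hopf_algebra_scheme \<Rightarrow> ('k, 'a \<Rightarrow> 'k) hopf_algebra" where
  "dual_hopf A =
    module.extend (dual_algebra A)
      (hopf_algebra.fields
        (\<lambda>f. THE T. T \<in> carrier (tensor (dual_algebra A) (dual_algebra A)) \<and>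
           (\<forall>a\<in>carrier A. \<forall>b\<in>carrier A. dual_tensor_eval T a b = f (a \<otimes>\<^bsub>A\<^esub> b)))
        (\<lambda>f. f \<one>\<^bsub>A\<^esub>)
        (\<lambda>f. \<lambda>x\<in>carrier A. f (antipode A x)))"

definition self_dual :: "('k::field, 'a, 'z) hopf_algebra_scheme \<Rightarrow> bool" where
  "self_dual A \<longleftrightarrow> hopf_iso A (dual_hopf A) \<noteq> {}"


subsection \<open>Suzuki's Hopf algebras\<close>

text \<open>The pair \<open>(i, j)\<close> is the generator \<open>x\<^sub>i\<^sub>j\<close>.  The signs usually called
  \<open>\<nu>, \<lambda> = \<plusminus>1\<close> are the scalars \<open>\<nu>, \<mu>\<close>.\<close>

type_synonym gen = "nat \<times> nat"

definition suzuki_gens :: "gen set" where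
  "suzuki_gens = {1, 2} \<times> {1, 2}"

abbreviation word :: "gen list \<Rightarrow> (gen list \<Rightarrow>\<^sub>0 'k::field)" where
  "word w \<equiv> Poly_Mapping.single w 1"

text \<open>The word \<open>a b a \<dots>\<close> of length \<open>n\<close>.\<close>

definition alternating :: "nat \<Rightarrow> 'g \<Rightarrow> 'g \<Rightarrow> 'g list" where
  "alternating n a b = map (\<lambda>i. if even i then a else b) [0..<n]"

text \<open>A relation \<open>u = v\<close> is encoded as the element \<open>u - v\<close> of the free algebra.\<close>

definition suzuki_relations ::
    "nat \<Rightarrow> nat \<Rightarrow> 'k::field \<Rightarrow> 'k \<Rightarrow> (gen list \<Rightarrow>\<^sub>0 'k) set" where
  "suzuki_relations N n \<nu> \<mu> =
     {word [(1,1), (1,1)] - word [(2,2), (2,2)],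
      word [(1,2), (1,2)] - word [(2,1), (2,1)]}
   \<union> {word [(i,j), (l,m)] | i j l m.
        (i,j) \<in> suzuki_gens \<and> (l,m) \<in> suzuki_gens \<and>
        (int i - int j) mod 2 \<noteq> (int l - int m) mod 2}
   \<union> {word (replicate (2 * N) (1,1)) + scale \<nu> (word (replicate (2 * N) (1,2))) - word [],
      word (alternating n (1,1) (2,2)) - word (alternating n (2,2) (1,1)),
      word (alternating n (2,1) (1,2)) - scale \<mu> (word (alternating n (1,2) (2,1)))}"

definition suzuki_ideal ::
    "nat \<Rightarrow> nat \<Rightarrow> 'k::field \<Rightarrow> 'k \<Rightarrow> (gen list \<Rightarrow>\<^sub>0 'k) set" where
  "suzuki_ideal N n \<nu> \<mu> = Idl\<^bsub>free_algebra suzuki_gens\<^esub> (suzuki_relations N n \<nu> \<mu>)"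

definition suzuki_algebra ::
    "nat \<Rightarrow> nat \<Rightarrow> 'k::field \<Rightarrow> 'k \<Rightarrow> ('k, (gen list \<Rightarrow>\<^sub>0 'k) set) module" where
  "suzuki_algebra N n \<nu> \<mu> =
    quotient_algebra (free_algebra suzuki_gens) (suzuki_ideal N n \<nu> \<mu>)"

definition suzuki_x ::
    "nat \<Rightarrow> nat \<Rightarrow> 'k::field \<Rightarrow> 'k \<Rightarrow> gen \<Rightarrow> (gen list \<Rightarrow>\<^sub>0 'k) set" where
  "suzuki_x N n \<nu> \<mu> g = suzuki_ideal N n \<nu> \<mu> +>\<^bsub>free_algebra suzuki_gens\<^esub> word [g]"

text \<open>\<open>\<Delta>\<close> and \<open>\<epsilon>\<close> are algebra maps, \<open>S\<close> is an anti-homomorphism, that is, an algebra map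
  to the opposite algebra.  The formula \<open>S(x\<^sub>i\<^sub>j) = x\<^sub>j\<^sub>i ^ (2N - 1)\<close> is an antipode for
  \<open>\<nu> = 1\<close> only; \<open>\<nu> = -1 \<noteq> 1\<close> would need the exponent \<open>4N - 1\<close>, which agrees with
  \<open>2N - 1\<close> for \<open>\<nu> = 1\<close>.\<close>

definition suzuki_hopf ::
    "nat \<Rightarrow> nat \<Rightarrow> 'k::field \<Rightarrow> 'k \<Rightarrow> ('k, (gen list \<Rightarrow>\<^sub>0 'k) set) hopf_algebra" where
  "suzuki_hopf N n \<nu> \<mu> =
    (let A = suzuki_algebra N n \<nu> \<mu>;
         x = (\<lambda>i j. suzuki_x N n \<nu> \<mu> (i, j))
     in module.extend A
          (hopf_algebra.fields
            (presented_hom (tensor A A)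
              (\<lambda>(i, j). pure_tensor A A (x i 1) (x 1 j) \<oplus>\<^bsub>tensor A A\<^esub> pure_tensor A A (x i 2) (x 2 j)))
            (presented_hom scalars (\<lambda>(i, j). if i = j then 1 else 0))
            (presented_hom (opposite A) (\<lambda>(i, j). x j i [^]\<^bsub>A\<^esub> (2 * N - 1)))))"

end

theory Submission
  imports Defs
begin

text \<open>
  The algebras \<open>A = A\<^sub>N\<^sub>n\<^sup>+\<^sup>+\<close> and \<open>A\<^sup>*\<close> are already not isomorphic as algebras, because \<open>A\<close> has at least
  \<open>8N\<close> characters and \<open>A\<^sup>*\<close> has at most \<open>4N\<close>.

  The idempotents \<open>x\<^sub>1\<^sub>1\<^sup>2\<^sup>N\<close> and \<open>x\<^sub>1\<^sub>2\<^sup>2\<^sup>N\<close> split \<open>A\<close> into two copies of the group algebra of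
  \<open>G = \<langle>a, b | a\<^sup>2 = b\<^sup>2, a\<^sup>2\<^sup>N = 1, aba\<dots> = bab\<dots>\<rangle>\<close>, and for even \<open>n\<close> each copy has the characters
  \<open>a \<mapsto> \<alpha>, b \<mapsto> \<plusminus>\<alpha>\<close> with \<open>\<alpha>\<^sup>2\<^sup>N = 1\<close>.  An element of \<open>G\<close> is determined by the pair \<open>(l, r)\<close>, where \<open>l\<close> modulo
  \<open>2N\<close> is the length of a word and \<open>r\<close> modulo \<open>n\<close> is the sum of the signs \<open>(-1)\<^sup>i\<close> over the
  positions \<open>i\<close> of the letter \<open>b\<close>.
  If \<open>\<sigma>\<close> exchanges \<open>a\<close> and \<open>b\<close>, the coproduct is
  \<open>g\<^sub>0 \<mapsto> g\<^sub>0 \<otimes> g\<^sub>0 + g\<^sub>1 \<otimes> \<sigma>(g)\<^sub>1\<close>, \<open>g\<^sub>1 \<mapsto> g\<^sub>0 \<otimes> g\<^sub>1 + g\<^sub>1 \<otimes> \<sigma>(g)\<^sub>0\<close>, so that \<open>A\<^sup>*\<close> is the crossed product of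
  the functions on \<open>G\<close> with the group of order two generated by \<open>\<sigma>\<close>.  Its characters correspond to a
  fixed point of \<open>\<sigma>\<close> and a sign, and for even \<open>n\<close> there are \<open>2N\<close> fixed points, the pairs \<open>(l, r)\<close>
  with \<open>l\<close> even and \<open>r \<in> {0, n/2}\<close>.
\<close>

subsection \<open>Associative algebras over a field\<close>

text \<open>Commutativity is not assumed, since free algebras and their quotients are noncommutative
  in general. Scalars form the whole type \<open>'k\<close> and carry no membership
  conditions.\<close>

locale assoc_algebra = ring A for A :: "('k::field, 'a, 'z) module_scheme" (structure) +
  assumes smult_closed [simp, intro]: "x \<in> carrier A \<Longrightarrow> c \<odot> x \<in> carrier A"
    and smult_add_left: "x \<in> carrier A \<Longrightarrow> (c + d) \<odot> x = c \<odot> x \<oplus> d \<odot> x"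
    and smult_add_right: "x \<in> carrier A \<Longrightarrow> y \<in> carrier A \<Longrightarrow> c \<odot> (x \<oplus> y) = c \<odot> x \<oplus> c \<odot> y"
    and smult_smult: "x \<in> carrier A \<Longrightarrow> c \<odot> (d \<odot> x) = (c * d) \<odot> x"
    and smult_one [simp]: "x \<in> carrier A \<Longrightarrow> 1 \<odot> x = x"
    and mult_smult_left: "x \<in> carrier A \<Longrightarrow> y \<in> carrier A \<Longrightarrow> (c \<odot> x) \<otimes> y = c \<odot> (x \<otimes> y)"
    and mult_smult_right: "x \<in> carrier A \<Longrightarrow> y \<in> carrier A \<Longrightarrow> x \<otimes> (c \<odot> y) = c \<odot> (x \<otimes> y)"
begin

lemma smult_zero_left [simp]:
  assumes "x \<in> carrier A"
  shows "0 \<odot> x = \<zero>"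
proof -
  have "0 \<odot> x \<oplus> 0 \<odot> x = 0 \<odot> x" using smult_add_left[OF assms, of 0 0] by simp
  then show ?thesis using assms by (metis add.l_cancel_one smult_closed)
qed

lemma smult_zero_right [simp]: "c \<odot> \<zero> = \<zero>"
  using smult_smult[of \<zero> c 0] by simp

end

lemma scalars_simps [simp]:
  "carrier scalars = UNIV" "x \<otimes>\<^bsub>scalars\<^esub> y = x * y" "\<one>\<^bsub>scalars\<^esub> = 1"
  "\<zero>\<^bsub>scalars\<^esub> = 0" "x \<oplus>\<^bsub>scalars\<^esub> y = x + y" "c \<odot>\<^bsub>scalars\<^esub> x = c * x"
  by (simp_all add: scalars_def)

text \<open>With the ground field as a target algebra, characters and linear forms fall under the
  same extension results as algebra maps.\<close>

lemma scalars_algebra: "assoc_algebra (scalars :: ('k::field, 'k) module)"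
proof -
  have "abelian_group (scalars :: ('k, 'k) module)"
  proof (rule abelian_groupI)
    fix x :: 'k
    assume "x \<in> carrier scalars"
    show "\<exists>y\<in>carrier scalars. y \<oplus>\<^bsub>scalars\<^esub> x = \<zero>\<^bsub>scalars\<^esub>"
      by (rule bexI[of _ "- x"]) (auto simp: scalars_def)
  qed (auto simp: scalars_def)
  moreover have "monoid (scalars :: ('k, 'k) module)"
    by (rule monoidI) (auto simp: scalars_def)
  ultimately have "ring (scalars :: ('k, 'k) module)"
    by (intro ringI) (auto simp: scalars_def algebra_simps)
  then show ?thesis
    by (intro assoc_algebra.intro assoc_algebra_axioms.intro) (auto simp: scalars_def algebra_simps)
qed


subsection \<open>Linear extension from a basis\<close>

lemma lookup_scale [simp]: "Poly_Mapping.lookup (scale c f) p = c * Poly_Mapping.lookup f p"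
  unfolding scale_def by transfer (auto simp: when_def)

lemma keys_scale: "Poly_Mapping.keys (scale c f) \<subseteq> Poly_Mapping.keys f"
  by (auto simp: in_keys_iff)

lemma scale_single [simp]: "scale c (Poly_Mapping.single p x) = Poly_Mapping.single p (c * x)"
  by (rule poly_mapping_eqI) (auto simp: lookup_single when_def)

lemma scale_add [simp]: "scale c (f + g) = scale c f + scale c g"
  by (rule poly_mapping_eqI) (auto simp: lookup_add algebra_simps)

lemma scale_sum: "scale c (sum h S) = (\<Sum>i\<in>S. scale c (h i))"
  by (rule poly_mapping_eqI) (simp add: lookup_sum sum_distrib_left)

lemma scale_zero [simp]: "scale c 0 = 0"
  by (rule poly_mapping_eqI) simp

lemma scale_module: "Modules.module (scale :: 'k::field \<Rightarrow> ('m \<Rightarrow>\<^sub>0 'k) \<Rightarrow> _)"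
  by unfold_locales (auto intro!: poly_mapping_eqI simp: lookup_add algebra_simps)

text \<open>Induction on the size of the support: subtracting one monomial removes exactly its key.
  The bound \<open>X\<close> is kept along the way, so that the induction stays inside the carrier
  of a monoid algebra.\<close>

lemma poly_mapping_keys_induct [consumes 1, case_names zero single_add]:
  assumes "Poly_Mapping.keys f \<subseteq> X"
    and "P 0"
    and step: "\<And>p c g. p \<in> X \<Longrightarrow> Poly_Mapping.keys g \<subseteq> X \<Longrightarrow> P g
      \<Longrightarrow> P (Poly_Mapping.single p c + g :: 'm \<Rightarrow>\<^sub>0 'k::ab_group_add)"
  shows "P f"
  using assms(1)
proof (induction "card (Poly_Mapping.keys f)" arbitrary: f)
  case 0
  then show ?case using assms(2) by simp
next
  case (Suc k)
  then obtain p where p: "p \<in> Poly_Mapping.keys f"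
    by (metis card.empty ex_in_conv nat.distinct(1))
  define g where "g = f - Poly_Mapping.single p (Poly_Mapping.lookup f p)"
  have keys: "Poly_Mapping.keys g = Poly_Mapping.keys f - {p}"
    by (auto simp: g_def in_keys_iff lookup_minus lookup_single when_def split: if_splits)
  have "P g" using Suc p keys by (intro Suc.hyps(1)) auto
  then have "P (Poly_Mapping.single p (Poly_Mapping.lookup f p) + g)"
    using Suc.prems p keys by (intro step) auto
  then show ?case by (simp add: g_def)
qed

context assoc_algebra
begin

lemma linear_ext_closed:
  assumes "Poly_Mapping.keys f \<subseteq> X" "\<phi> \<in> X \<rightarrow> carrier A"
  shows "linear_ext A \<phi> f \<in> carrier A"
  unfolding linear_ext_def using assms by (intro finsum_closed) auto

text \<open>Extra indices have coefficient zero. A common index set is needed to compare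
  \<open>f\<close>, \<open>g\<close> and \<open>f + g\<close>, because the support of a sum may
  shrink by cancellation.\<close>

lemma linear_ext_superset:
  assumes "finite S" "Poly_Mapping.keys f \<subseteq> S" "\<phi> \<in> S \<rightarrow> carrier A"
  shows "linear_ext A \<phi> f = (\<Oplus>p\<in>S. Poly_Mapping.lookup f p \<odot> \<phi> p)"
  unfolding linear_ext_def using assms
  by (intro add.finprod_mono_neutral_cong_left) (auto simp: in_keys_iff Pi_iff)

lemma linear_ext_zero [simp]: "linear_ext A \<phi> 0 = \<zero>"
  by (simp add: linear_ext_def)

lemma linear_ext_single [simp]:
  assumes "\<phi> p \<in> carrier A"
  shows "linear_ext A \<phi> (Poly_Mapping.single p c) = c \<odot> \<phi> p"
proof -
  have "linear_ext A \<phi> (Poly_Mapping.single p c) =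
      (\<Oplus>q\<in>{p}. Poly_Mapping.lookup (Poly_Mapping.single p c) q \<odot> \<phi> q)"
    using assms by (intro linear_ext_superset) auto
  also have "\<dots> = c \<odot> \<phi> p" using assms by simp
  finally show ?thesis .
qed

lemma linear_ext_add:
  assumes "Poly_Mapping.keys f \<subseteq> X" "Poly_Mapping.keys g \<subseteq> X" "\<phi> \<in> X \<rightarrow> carrier A"
  shows "linear_ext A \<phi> (f + g) = linear_ext A \<phi> f \<oplus> linear_ext A \<phi> g"
proof -
  let ?S = "Poly_Mapping.keys f \<union> Poly_Mapping.keys g"
  have S: "finite ?S" "Poly_Mapping.keys (f + g) \<subseteq> ?S" "\<phi> \<in> ?S \<rightarrow> carrier A"
    using keys_add[of f g] assms by auto
  have "linear_ext A \<phi> (f + g) =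
      (\<Oplus>p\<in>?S. Poly_Mapping.lookup f p \<odot> \<phi> p \<oplus> Poly_Mapping.lookup g p \<odot> \<phi> p)"
    unfolding linear_ext_superset[OF S] using S(3)
    by (intro finsum_cong') (auto simp: lookup_add smult_add_left Pi_iff)
  also have "\<dots> = linear_ext A \<phi> f \<oplus> linear_ext A \<phi> g"
    unfolding linear_ext_superset[OF S(1) Un_upper1 S(3)] linear_ext_superset[OF S(1) Un_upper2 S(3)]
    using S(3) by (intro finsum_addf) auto
  finally show ?thesis .
qed

lemma linear_ext_scale:
  assumes "Poly_Mapping.keys f \<subseteq> X" "\<phi> \<in> X \<rightarrow> carrier A"
  shows "linear_ext A \<phi> (scale c f) = c \<odot> linear_ext A \<phi> f"
  using assms(1)
proof (induction f rule: poly_mapping_keys_induct)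
  case zero
  show ?case by simp
next
  case (single_add p d g)
  have p: "\<phi> p \<in> carrier A" using single_add assms by auto
  have cl: "linear_ext A \<phi> g \<in> carrier A" using single_add assms by (intro linear_ext_closed)
  have "linear_ext A \<phi> (scale c (Poly_Mapping.single p d + g)) =
      linear_ext A \<phi> (Poly_Mapping.single p (c * d)) \<oplus> linear_ext A \<phi> (scale c g)"
    unfolding scale_add scale_single using single_add assms keys_scale[of c g]
    by (intro linear_ext_add[where X = X]) auto
  also have "\<dots> = c \<odot> (linear_ext A \<phi> (Poly_Mapping.single p d) \<oplus> linear_ext A \<phi> g)"
    using p cl single_add by (simp add: smult_smult smult_add_right)
  also have "linear_ext A \<phi> (Poly_Mapping.single p d) \<oplus> linear_ext A \<phi> g
      = linear_ext A \<phi> (Poly_Mapping.single p d + g)"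
    using single_add assms by (intro linear_ext_add[where X = X, symmetric]) auto
  finally show ?case .
qed

end


subsection \<open>Monoid algebras\<close>

lemma monoid_algebra_simps [simp]:
  "carrier (monoid_algebra M) = {f. Poly_Mapping.keys f \<subseteq> carrier M}"
  "\<one>\<^bsub>monoid_algebra M\<^esub> = Poly_Mapping.single \<one>\<^bsub>M\<^esub> 1"
  "\<zero>\<^bsub>monoid_algebra M\<^esub> = 0"
  "f \<oplus>\<^bsub>monoid_algebra M\<^esub> g = f + g"
  "c \<odot>\<^bsub>monoid_algebra M\<^esub> f = scale c f"
  by (simp_all add: monoid_algebra_def)

text \<open>Padding the supports with zero coefficients turns bilinearity of the product into
  distributivity over fixed finite sums.\<close>

lemma monoid_algebra_mult_superset:
  assumes "finite S" "finite T" "Poly_Mapping.keys f \<subseteq> S" "Poly_Mapping.keys g \<subseteq> T"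
  shows "f \<otimes>\<^bsub>monoid_algebra M\<^esub> g = (\<Sum>p\<in>S. \<Sum>q\<in>T.
    Poly_Mapping.single (p \<otimes>\<^bsub>M\<^esub> q) (Poly_Mapping.lookup f p * Poly_Mapping.lookup g q))"
proof -
  have "f \<otimes>\<^bsub>monoid_algebra M\<^esub> g = (\<Sum>p\<in>Poly_Mapping.keys f. \<Sum>q\<in>T.
    Poly_Mapping.single (p \<otimes>\<^bsub>M\<^esub> q) (Poly_Mapping.lookup f p * Poly_Mapping.lookup g q))"
    unfolding monoid_algebra_def using assms
    by (auto intro!: sum.cong[OF refl sum.mono_neutral_left] simp: in_keys_iff)
  also have "\<dots> = (\<Sum>p\<in>S. \<Sum>q\<in>T.
    Poly_Mapping.single (p \<otimes>\<^bsub>M\<^esub> q) (Poly_Mapping.lookup f p * Poly_Mapping.lookup g q))"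
    using assms by (intro sum.mono_neutral_left) (auto simp: in_keys_iff)
  finally show ?thesis .
qed

lemma monoid_algebra_mult_single [simp]:
  "Poly_Mapping.single p c \<otimes>\<^bsub>monoid_algebra M\<^esub> Poly_Mapping.single q d =
    Poly_Mapping.single (p \<otimes>\<^bsub>M\<^esub> q) (c * d)"
  by (subst monoid_algebra_mult_superset[of "{p}" "{q}"]) auto

lemma monoid_algebra_mult_zero [simp]:
  "0 \<otimes>\<^bsub>monoid_algebra M\<^esub> g = 0" "f \<otimes>\<^bsub>monoid_algebra M\<^esub> 0 = 0"
  by (simp_all add: monoid_algebra_def)

lemma monoid_algebra_mult_add_left:
  "(f + f') \<otimes>\<^bsub>monoid_algebra M\<^esub> g =
    f \<otimes>\<^bsub>monoid_algebra M\<^esub> g + f' \<otimes>\<^bsub>monoid_algebra M\<^esub> g"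
proof -
  let ?S = "Poly_Mapping.keys f \<union> Poly_Mapping.keys f'" and ?T = "Poly_Mapping.keys g"
  show ?thesis
    using keys_add[of f f']
    by (simp add: monoid_algebra_mult_superset[of ?S ?T] lookup_add distrib_right
        single_add sum.distrib)
qed

lemma monoid_algebra_mult_add_right:
  "f \<otimes>\<^bsub>monoid_algebra M\<^esub> (g + g') =
    f \<otimes>\<^bsub>monoid_algebra M\<^esub> g + f \<otimes>\<^bsub>monoid_algebra M\<^esub> g'"
proof -
  let ?S = "Poly_Mapping.keys f" and ?T = "Poly_Mapping.keys g \<union> Poly_Mapping.keys g'"
  show ?thesis
    using keys_add[of g g']
    by (simp add: monoid_algebra_mult_superset[of ?S ?T] lookup_add distrib_left
        single_add sum.distrib)
qed

lemma monoid_algebra_mult_scale_left: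
  "scale c f \<otimes>\<^bsub>monoid_algebra M\<^esub> g = scale c (f \<otimes>\<^bsub>monoid_algebra M\<^esub> g)"
proof -
  show ?thesis
    using keys_scale[of c f]
    by (simp add: monoid_algebra_mult_superset[of "Poly_Mapping.keys f" "Poly_Mapping.keys g"]
        scale_sum mult.assoc)
qed

lemma monoid_algebra_mult_scale_right:
  "f \<otimes>\<^bsub>monoid_algebra M\<^esub> scale c g = scale c (f \<otimes>\<^bsub>monoid_algebra M\<^esub> g)"
proof -
  show ?thesis
    using keys_scale[of c g]
    by (simp add: monoid_algebra_mult_superset[of "Poly_Mapping.keys f" "Poly_Mapping.keys g"]
        scale_sum mult.left_commute)
qed

lemma (in monoid) monoid_algebra_mult_closed:
  assumes "Poly_Mapping.keys f \<subseteq> carrier G" "Poly_Mapping.keys g \<subseteq> carrier G"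
  shows "Poly_Mapping.keys (f \<otimes>\<^bsub>monoid_algebra G\<^esub> g) \<subseteq> carrier G"
  using assms(1)
proof (induction f rule: poly_mapping_keys_induct)
  case (single_add p c f)
  have "Poly_Mapping.keys (Poly_Mapping.single p c \<otimes>\<^bsub>monoid_algebra G\<^esub> g) \<subseteq> carrier G"
    using assms(2)
  proof (induction g rule: poly_mapping_keys_induct)
    case (single_add q d g)
    then show ?case
      using \<open>p \<in> carrier G\<close>
      by (auto simp: monoid_algebra_mult_add_right intro!: subset_trans[OF keys_add] split: if_splits)
  qed simp
  then show ?case
    using single_add
    by (auto simp: monoid_algebra_mult_add_left intro!: subset_trans[OF keys_add] split: if_splits)
qed simp

text \<open>Both sides are trilinear, so three nested inductions on supports leave only monomials,
  where associativity of \<open>G\<close> applies.\<close>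

lemma (in monoid) monoid_algebra_assoc:
  assumes "Poly_Mapping.keys f \<subseteq> carrier G" "Poly_Mapping.keys g \<subseteq> carrier G"
    "Poly_Mapping.keys h \<subseteq> carrier G"
  shows "f \<otimes>\<^bsub>monoid_algebra G\<^esub> g \<otimes>\<^bsub>monoid_algebra G\<^esub> h =
    f \<otimes>\<^bsub>monoid_algebra G\<^esub> (g \<otimes>\<^bsub>monoid_algebra G\<^esub> h)"
  using assms(1)
proof (induction f rule: poly_mapping_keys_induct)
  case (single_add p c f)
  note p = \<open>p \<in> carrier G\<close>
  let ?p = "Poly_Mapping.single p c"
  have "?p \<otimes>\<^bsub>monoid_algebra G\<^esub> g \<otimes>\<^bsub>monoid_algebra G\<^esub> h =
    ?p \<otimes>\<^bsub>monoid_algebra G\<^esub> (g \<otimes>\<^bsub>monoid_algebra G\<^esub> h)"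
    using assms(2)
  proof (induction g rule: poly_mapping_keys_induct)
    case (single_add q d g)
    let ?q = "Poly_Mapping.single q d"
    have "?p \<otimes>\<^bsub>monoid_algebra G\<^esub> ?q \<otimes>\<^bsub>monoid_algebra G\<^esub> h =
      ?p \<otimes>\<^bsub>monoid_algebra G\<^esub> (?q \<otimes>\<^bsub>monoid_algebra G\<^esub> h)"
      using assms(3)
      by (induction h rule: poly_mapping_keys_induct)
        (use p single_add in \<open>simp_all add: monoid_algebra_mult_add_right m_assoc mult.assoc\<close>)
    then show ?case
      using single_add
      by (simp add: monoid_algebra_mult_add_left monoid_algebra_mult_add_right
          del: monoid_algebra_mult_single)
  qed simp
  then show ?case
    using single_add by (simp add: monoid_algebra_mult_add_left)
qed simp

lemma (in monoid) monoid_algebra_one: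
  assumes "Poly_Mapping.keys f \<subseteq> carrier G"
  shows "Poly_Mapping.single \<one> 1 \<otimes>\<^bsub>monoid_algebra G\<^esub> f = f"
    "f \<otimes>\<^bsub>monoid_algebra G\<^esub> Poly_Mapping.single \<one> 1 = f"
  using assms
  by (induction f rule: poly_mapping_keys_induct)
    (simp_all add: monoid_algebra_mult_add_left monoid_algebra_mult_add_right)

lemma (in monoid) monoid_algebra: "assoc_algebra (monoid_algebra G :: ('k::field, _) module)"
proof -
  let ?A = "monoid_algebra G :: ('k, _) module"
  have "abelian_group ?A"
  proof (rule abelian_groupI)
    fix f assume "f \<in> carrier ?A"
    then show "\<exists>y\<in>carrier ?A. y \<oplus>\<^bsub>?A\<^esub> f = \<zero>\<^bsub>?A\<^esub>"
      by (intro bexI[of _ "- f"]) auto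
  next
    fix f g assume "f \<in> carrier ?A" "g \<in> carrier ?A"
    then show "f \<oplus>\<^bsub>?A\<^esub> g \<in> carrier ?A" using keys_add[of f g] by auto
  qed (auto simp: algebra_simps)
  moreover have "monoid ?A"
    by (rule monoidI) (auto simp: monoid_algebra_assoc monoid_algebra_one
        dest: subsetD[OF monoid_algebra_mult_closed])
  ultimately have "ring ?A"
    by (intro ringI) (auto simp: monoid_algebra_mult_add_left monoid_algebra_mult_add_right)
  moreover have "scale (c + d) f = scale c f + scale d f"
    and "scale c (scale d f) = scale (c * d) f" and "scale 1 f = f"
    for c d :: 'k and f :: "'a \<Rightarrow>\<^sub>0 'k"
    by (rule poly_mapping_eqI; simp add: lookup_add algebra_simps)+
  moreover have "scale c f \<in> carrier ?A" if "f \<in> carrier ?A" for c f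
    using that keys_scale[of c f] by auto
  ultimately show ?thesis
    by (intro assoc_algebra.intro assoc_algebra_axioms.intro)
      (simp_all only: monoid_algebra_simps scale_add monoid_algebra_mult_scale_left
        monoid_algebra_mult_scale_right)
qed

lemma monoid_algebra_a_inv:
  assumes "monoid M" "f \<in> carrier (monoid_algebra M)"
  shows "\<ominus>\<^bsub>monoid_algebra M\<^esub> f = - f"
proof -
  interpret assoc_algebra "monoid_algebra M :: ('k::field, _) module"
    using assms(1) by (rule monoid.monoid_algebra)
  show ?thesis using assms by (intro minus_equality) auto
qed

lemma monoid_algebra_minus:
  assumes "monoid M" "f \<in> carrier (monoid_algebra M)" "g \<in> carrier (monoid_algebra M)"
  shows "f \<ominus>\<^bsub>monoid_algebra M\<^esub> g = f - g"
  by (simp add: a_minus_def monoid_algebra_a_inv[OF assms(1,3)])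

context assoc_algebra
begin

text \<open>Both sides are bilinear in \<open>f\<close> and \<open>g\<close>, so multiplicativity of
  \<open>\<phi>\<close> on the basis is enough.\<close>

lemma linear_ext_mult:
  assumes "monoid M" "\<phi> \<in> carrier M \<rightarrow> carrier A"
    and mult: "\<And>p q. p \<in> carrier M \<Longrightarrow> q \<in> carrier M \<Longrightarrow> \<phi> (p \<otimes>\<^bsub>M\<^esub> q) = \<phi> p \<otimes> \<phi> q"
    and f: "Poly_Mapping.keys f \<subseteq> carrier M" and g: "Poly_Mapping.keys g \<subseteq> carrier M"
  shows "linear_ext A \<phi> (f \<otimes>\<^bsub>monoid_algebra M\<^esub> g) = linear_ext A \<phi> f \<otimes> linear_ext A \<phi> g"
proof -
  interpret M: monoid M by fact
  note add = linear_ext_add[OF _ _ assms(2)]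
  note cl = linear_ext_closed[OF _ assms(2)] M.monoid_algebra_mult_closed
  show ?thesis
    using f
  proof (induction f rule: poly_mapping_keys_induct)
    case zero
    then show ?case using cl[OF g] by simp
  next
    case (single_add p c f)
    let ?p = "Poly_Mapping.single p c"
    have p: "p \<in> carrier M" "\<phi> p \<in> carrier A" using single_add assms by auto
    have pk: "Poly_Mapping.keys ?p \<subseteq> carrier M" using p by simp
    have "linear_ext A \<phi> (?p \<otimes>\<^bsub>monoid_algebra M\<^esub> g) = linear_ext A \<phi> ?p \<otimes> linear_ext A \<phi> g"
      using g
    proof (induction g rule: poly_mapping_keys_induct)
      case zero
      then show ?case using p by simp
    next
      case (single_add q d g)
      have q: "q \<in> carrier M" "\<phi> q \<in> carrier A" using single_add assms by auto
      have qk: "Poly_Mapping.keys (Poly_Mapping.single q d) \<subseteq> carrier M" using q by simp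
      have "linear_ext A \<phi> (?p \<otimes>\<^bsub>monoid_algebra M\<^esub> (Poly_Mapping.single q d + g)) =
          linear_ext A \<phi> (?p \<otimes>\<^bsub>monoid_algebra M\<^esub> Poly_Mapping.single q d)
          \<oplus> linear_ext A \<phi> (?p \<otimes>\<^bsub>monoid_algebra M\<^esub> g)"
        unfolding monoid_algebra_mult_add_right
        using pk qk single_add by (intro add cl)
      also have "\<dots> = linear_ext A \<phi> ?p \<otimes> (linear_ext A \<phi> (Poly_Mapping.single q d) \<oplus> linear_ext A \<phi> g)"
        using p q single_add cl
        by (simp add: mult mult_smult_left mult_smult_right smult_smult smult_add_right r_distr mult.commute)
      also have "linear_ext A \<phi> (Poly_Mapping.single q d) \<oplus> linear_ext A \<phi> g
          = linear_ext A \<phi> (Poly_Mapping.single q d + g)"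
        using qk single_add by (intro add[symmetric])
      finally show ?case .
    qed
    then show ?case
      using single_add g p cl
      by (simp add: monoid_algebra_mult_add_left add[OF cl(2)[OF pk g] cl(2)] add[OF pk] l_distr
          del: linear_ext_single)
  qed
qed

lemma linear_ext_minus:
  assumes "Poly_Mapping.keys f \<subseteq> X" "Poly_Mapping.keys g \<subseteq> X" "\<phi> \<in> X \<rightarrow> carrier A"
  shows "linear_ext A \<phi> (f - g) = linear_ext A \<phi> f \<ominus> linear_ext A \<phi> g"
proof -
  have "linear_ext A \<phi> (f - g) \<oplus> linear_ext A \<phi> g = linear_ext A \<phi> (f - g + g)"
    using assms keys_diff[of f g] by (intro linear_ext_add[symmetric, where X = X]) auto
  then have "linear_ext A \<phi> f = linear_ext A \<phi> (f - g) \<oplus> linear_ext A \<phi> g" by simp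
  moreover have "linear_ext A \<phi> (f - g) \<in> carrier A" "linear_ext A \<phi> g \<in> carrier A"
    using assms keys_diff[of f g] by (auto intro!: linear_ext_closed[where X = X])
  ultimately show ?thesis by (simp add: minus_eq a_assoc r_neg)
qed

end

subsection \<open>Quotients\<close>

text \<open>The ring laws depend on these five fields only, so they pass between records of
  different types, here from \<open>R Quot I\<close> to its extension by a scalar
  multiplication.\<close>

lemma ring_cong:
  assumes "ring R" "carrier S = carrier R" "monoid.mult S = monoid.mult R" "one S = one R"
    "ring.zero S = ring.zero R" "add S = add R"
  shows "ring S"
proof -
  interpret ring R by fact
  have "abelian_group S"
    by (rule abelian_groupI; unfold assms(2-))
      (auto intro: a_assoc a_comm l_neg[OF _] a_inv_closed)
  moreover have "monoid S"
    by (rule monoidI; unfold assms(2-)) (auto intro: m_assoc)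
  ultimately show ?thesis
    by (rule ringI; unfold assms(2-)) (auto intro: l_distr r_distr)
qed

locale algebra_ideal = assoc_algebra R + ideal I R
  for R :: "('k::field, 'a, 'z) module_scheme" (structure) and I
begin

abbreviation "Q \<equiv> quotient_algebra R I"

text \<open>A ring ideal is closed under scalars because
  \<open>c \<odot> i = (c \<odot> \<one>) \<otimes> i\<close>.\<close>

lemma ideal_smult: "i \<in> I \<Longrightarrow> c \<odot> i \<in> I"
  using I_l_closed[of i "c \<odot> \<one>"] a_subset by (auto simp: mult_smult_left)

lemma coset_eq_iff:
  "f \<in> carrier R \<Longrightarrow> g \<in> carrier R \<Longrightarrow> I +> f = I +> g \<longleftrightarrow> f \<ominus> g \<in> I"
  using quotient_eq_iff_same_a_r_cos[OF ideal_axioms, of f g] by simp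

lemma quotient_carrier: "carrier Q = (\<lambda>f. I +> f) ` carrier R"
  by (auto simp: quotient_algebra_def ring.defs module.defs FactRing_simps)

lemma quotient_coset_closed [simp, intro]: "f \<in> carrier R \<Longrightarrow> I +> f \<in> carrier Q"
  by (auto simp: quotient_carrier)

lemma quotient_simps:
  "\<one>\<^bsub>Q\<^esub> = I +> \<one>"
  "\<zero>\<^bsub>Q\<^esub> = I +> \<zero>"
  "f \<in> carrier R \<Longrightarrow> g \<in> carrier R \<Longrightarrow> (I +> f) \<otimes>\<^bsub>Q\<^esub> (I +> g) = I +> (f \<otimes> g)"
  "f \<in> carrier R \<Longrightarrow> g \<in> carrier R \<Longrightarrow> (I +> f) \<oplus>\<^bsub>Q\<^esub> (I +> g) = I +> (f \<oplus> g)"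
  using a_subset
  by (simp_all add: quotient_algebra_def ring.defs module.defs FactRing_def rcoset_mult_add
      a_rcos_sum a_coset_add_zero)

text \<open>The union in \<open>quotient_algebra\<close> runs over all representatives of the coset.
  They all yield the same coset, so the union collapses to it.\<close>

lemma quotient_smult:
  assumes "f \<in> carrier R"
  shows "c \<odot>\<^bsub>Q\<^esub> (I +> f) = I +> (c \<odot> f)"
proof -
  have "I +> (c \<odot> g) = I +> (c \<odot> f)" if g: "g \<in> I +> f" for g
  proof -
    obtain i where i: "i \<in> I" "g = i \<oplus> f"
      using g by (auto simp: a_r_coset_def r_coset_def)
    have "i \<in> carrier R" using i a_subset by auto
    then have "c \<odot> g \<ominus> c \<odot> f = c \<odot> i"
      using i assms by (simp add: smult_add_right minus_eq a_assoc r_neg)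
    then show ?thesis
      using i assms ideal_smult \<open>i \<in> carrier R\<close> by (subst coset_eq_iff) auto
  qed
  moreover have "f \<in> I +> f"
    using assms by (rule a_rcos_self)
  ultimately have "(\<Union>g\<in>I +> f. I +> (c \<odot> g)) = I +> (c \<odot> f)" by blast
  then show ?thesis
    by (simp add: quotient_algebra_def ring.defs module.defs)
qed

lemma quotient_algebra: "assoc_algebra Q"
proof -
  have "ring Q"
    by (rule ring_cong[OF quotient_is_ring])
      (simp_all add: quotient_algebra_def ring.defs module.defs)
  then show ?thesis
    by (intro assoc_algebra.intro assoc_algebra_axioms.intro)
      (auto simp: quotient_carrier quotient_simps quotient_smult smult_add_left smult_add_right
        smult_smult mult_smult_left mult_smult_right)
qed

end

text \<open>\<open>induced\<close> extracts the only element of the image of a coset. The image is a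
  singleton because representatives differ by elements of \<open>I\<close>, which the linear
  extension kills.\<close>

lemma induced_coset:
  assumes "assoc_algebra V" "monoid M" "\<phi> \<in> carrier M \<rightarrow> carrier V"
    and I: "additive_subgroup I (monoid_algebra M)"
    and zero: "\<And>i. i \<in> I \<Longrightarrow> linear_ext V \<phi> i = \<zero>\<^bsub>V\<^esub>"
    and f: "Poly_Mapping.keys f \<subseteq> carrier M"
  shows "induced V \<phi> (I +>\<^bsub>monoid_algebra M\<^esub> f) = linear_ext V \<phi> f"
proof -
  interpret V: assoc_algebra V by fact
  interpret R: assoc_algebra "monoid_algebra M" using assms(2) by (rule monoid.monoid_algebra)
  have "linear_ext V \<phi> g = linear_ext V \<phi> f" if g: "g \<in> I +>\<^bsub>monoid_algebra M\<^esub> f" for g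
  proof -
    obtain i where i: "i \<in> I" "g = i + f"
      using g by (auto simp: a_r_coset_def r_coset_def)
    have "Poly_Mapping.keys i \<subseteq> carrier M"
      using additive_subgroup.a_subset[OF I] i by auto
    then show ?thesis
      using i zero f V.linear_ext_add[OF _ f assms(3), of i] V.linear_ext_closed[OF f assms(3)]
      by simp
  qed
  moreover have "f \<in> I +>\<^bsub>monoid_algebra M\<^esub> f"
    using additive_subgroup.zero_closed[OF I]
    by (auto simp: a_r_coset_def r_coset_def intro!: bexI[of _ 0])
  ultimately have "linear_ext V \<phi> ` (I +>\<^bsub>monoid_algebra M\<^esub> f) = {linear_ext V \<phi> f}"
    by blast
  then show ?thesis by (simp add: induced_def)
qed


subsection \<open>Algebras given by generators and relations\<close>

lemma free_monoid_simps [simp]: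
  "carrier (free_monoid X) = lists X" "\<one>\<^bsub>free_monoid X\<^esub> = []" "p \<otimes>\<^bsub>free_monoid X\<^esub> q = p @ q"
  by (simp_all add: free_monoid_def)

lemma free_monoid: "monoid (free_monoid X)"
  by (rule monoidI) auto

lemma free_algebra: "assoc_algebra (free_algebra X :: ('k::field, _) module)"
  unfolding free_algebra_def by (rule monoid.monoid_algebra[OF free_monoid])

lemma word_value_simps [simp]:
  "word_value V v [] = \<one>\<^bsub>V\<^esub>"
  "word_value V v (g # w) = v g \<otimes>\<^bsub>V\<^esub> word_value V v w"
  by (simp_all add: word_value_def)

lemma (in monoid) word_value_closed:
  "w \<in> lists X \<Longrightarrow> v \<in> X \<rightarrow> carrier G \<Longrightarrow> word_value G v w \<in> carrier G"
  by (induction w) (auto simp: Pi_iff)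

lemma (in monoid) word_value_append:
  "p \<in> lists X \<Longrightarrow> q \<in> lists X \<Longrightarrow> v \<in> X \<rightarrow> carrier G
    \<Longrightarrow> word_value G v (p @ q) = word_value G v p \<otimes> word_value G v q"
proof (induction p)
  case Nil
  then show ?case using word_value_closed[of q X v] by (simp del: in_lists_conv_set)
next
  case (Cons g p)
  then have "v g \<in> carrier G" by auto
  then show ?case
    using Cons word_value_closed[of p X v] word_value_closed[of q X v]
    by (simp del: in_lists_conv_set add: m_assoc)
qed

lemma genideal_free_algebra:
  fixes S :: "('g list \<Rightarrow>\<^sub>0 'k::field) set"
  assumes "S \<subseteq> carrier (free_algebra X)"
  shows "algebra_ideal (free_algebra X) (Idl\<^bsub>free_algebra X\<^esub> S)"
proof -
  interpret assoc_algebra "free_algebra X :: ('k, _) module" by (rule free_algebra)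
  interpret ideal "Idl\<^bsub>free_algebra X\<^esub> S" "free_algebra X"
    using assms by (rule genideal_ideal)
  show ?thesis by unfold_locales
qed

text \<open>The universal property of a presentation: the linear extension is a ring homomorphism on
  the free algebra, and its kernel is an ideal containing \<open>S\<close>, hence containing the
  ideal generated by \<open>S\<close>.\<close>

lemma presented_hom_coset:
  fixes S :: "('g list \<Rightarrow>\<^sub>0 'k::field) set"
  assumes "assoc_algebra V" and v: "v \<in> X \<rightarrow> carrier V"
    and S: "S \<subseteq> carrier (free_algebra X)"
    and zero: "\<And>r. r \<in> S \<Longrightarrow> linear_ext V (word_value V v) r = \<zero>\<^bsub>V\<^esub>"
    and f: "Poly_Mapping.keys f \<subseteq> lists X"
  shows "presented_hom V v (Idl\<^bsub>free_algebra X\<^esub> S +>\<^bsub>free_algebra X\<^esub> f) =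
    linear_ext V (word_value V v) f"
proof -
  interpret V: assoc_algebra V by fact
  interpret F: assoc_algebra "free_algebra X :: ('k, _) module" by (rule free_algebra)
  interpret I: algebra_ideal "free_algebra X" "Idl\<^bsub>free_algebra X\<^esub> S"
    using S by (rule genideal_free_algebra)
  let ?h = "linear_ext V (word_value V v)"
  have wv: "word_value V v \<in> carrier (free_monoid X) \<rightarrow> carrier V"
    by (rule Pi_I) (rule V.word_value_closed[OF _ v], simp only: free_monoid_simps)
  have "?h \<in> ring_hom (free_algebra X) V"
  proof (rule ring_hom_memI)
    show "?h \<one>\<^bsub>free_algebra X\<^esub> = \<one>\<^bsub>V\<^esub>"
      by (simp add: free_algebra_def)
  next
    fix f g :: "'g list \<Rightarrow>\<^sub>0 'k"
    assume "f \<in> carrier (free_algebra X)" "g \<in> carrier (free_algebra X)"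
    then have fg: "Poly_Mapping.keys f \<subseteq> carrier (free_monoid X)"
      "Poly_Mapping.keys g \<subseteq> carrier (free_monoid X)" by (auto simp: free_algebra_def)
    show "?h f \<in> carrier V" using V.linear_ext_closed[OF fg(1) wv] .
    show "?h (f \<otimes>\<^bsub>free_algebra X\<^esub> g) = ?h f \<otimes>\<^bsub>V\<^esub> ?h g"
      unfolding free_algebra_def using v fg
      by (intro V.linear_ext_mult free_monoid wv) (auto intro!: V.word_value_append[where X = X])
    show "?h (f \<oplus>\<^bsub>free_algebra X\<^esub> g) = ?h f \<oplus>\<^bsub>V\<^esub> ?h g"
      using V.linear_ext_add[OF fg wv] by (simp add: free_algebra_def)
  qed
  then interpret h: ring_hom_ring "free_algebra X" V ?h
    by (intro ring_hom_ringI2) unfold_locales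
  have "S \<subseteq> a_kernel (free_algebra X) V ?h"
    unfolding a_kernel_def' using S zero by blast
  then have "Idl\<^bsub>free_algebra X\<^esub> S \<subseteq> a_kernel (free_algebra X) V ?h"
    by (rule F.genideal_minimal[OF h.kernel_is_ideal])
  then have "?h i = \<zero>\<^bsub>V\<^esub>" if "i \<in> Idl\<^bsub>free_algebra X\<^esub> S" for i
    using that unfolding a_kernel_def' by blast
  then show ?thesis
    unfolding presented_hom_def free_algebra_def
    using f I.is_additive_subgroup wv assms(1)
    by (intro induced_coset free_monoid) (auto simp: free_algebra_def)
qed


subsection \<open>Tensor products\<close>

lemma monoid_algebra_mult_diff:
  "(f - f') \<otimes>\<^bsub>monoid_algebra M\<^esub> g =
    f \<otimes>\<^bsub>monoid_algebra M\<^esub> g - f' \<otimes>\<^bsub>monoid_algebra M\<^esub> g"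
  "g \<otimes>\<^bsub>monoid_algebra M\<^esub> (f - f') =
    g \<otimes>\<^bsub>monoid_algebra M\<^esub> f - g \<otimes>\<^bsub>monoid_algebra M\<^esub> f'"
  by (simp_all add: eq_diff_eq flip: monoid_algebra_mult_add_left monoid_algebra_mult_add_right)

interpretation sc: Modules.module scale
  by (rule scale_module)

locale algebra_pair = A: assoc_algebra A + B: assoc_algebra B
  for A :: "('k::field, 'a, 'y) module_scheme" and B :: "('k, 'b, 'z) module_scheme"
begin

abbreviation F :: "('k, 'a \<times> 'b \<Rightarrow>\<^sub>0 'k) module" where "F \<equiv> monoid_algebra (A \<times>\<times> B)"
abbreviation K :: "('a \<times> 'b \<Rightarrow>\<^sub>0 'k) set" where "K \<equiv> tensor_kernel A B"

lemma DirProd_simps [simp]: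
  "carrier (A \<times>\<times> B) = carrier A \<times> carrier B"
  "\<one>\<^bsub>A \<times>\<times> B\<^esub> = (\<one>\<^bsub>A\<^esub>, \<one>\<^bsub>B\<^esub>)"
  "(a, b) \<otimes>\<^bsub>A \<times>\<times> B\<^esub> (a', b') = (a \<otimes>\<^bsub>A\<^esub> a', b \<otimes>\<^bsub>B\<^esub> b')"
  by (simp_all add: DirProd_def)

lemma DirProd_monoid': "monoid (A \<times>\<times> B)"
  by (rule DirProd_monoid) unfold_locales

sublocale F: assoc_algebra F
  by (rule monoid.monoid_algebra[OF DirProd_monoid'])

lemma bilinear_relations_cases [consumes 1, case_names add_left add_right smult_left smult_right]:
  assumes "r \<in> bilinear_relations A B"
  obtains
    a a' b where "a \<in> carrier A" "a' \<in> carrier A" "b \<in> carrier B"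
      "r = Poly_Mapping.single (a \<oplus>\<^bsub>A\<^esub> a', b) 1 - Poly_Mapping.single (a, b) 1
        - Poly_Mapping.single (a', b) 1"
  | a b b' where "a \<in> carrier A" "b \<in> carrier B" "b' \<in> carrier B"
      "r = Poly_Mapping.single (a, b \<oplus>\<^bsub>B\<^esub> b') 1 - Poly_Mapping.single (a, b) 1
        - Poly_Mapping.single (a, b') 1"
  | c a b where "a \<in> carrier A" "b \<in> carrier B"
      "r = Poly_Mapping.single (c \<odot>\<^bsub>A\<^esub> a, b) 1 - Poly_Mapping.single (a, b) c"
  | c a b where "a \<in> carrier A" "b \<in> carrier B"
      "r = Poly_Mapping.single (a, c \<odot>\<^bsub>B\<^esub> b) 1 - Poly_Mapping.single (a, b) c"
  using assms unfolding bilinear_relations_def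
  by (elim UnE CollectE exE conjE) (erule (3) that | erule (2) that)+

lemma bilinear_relationsI:
  "a \<in> carrier A \<Longrightarrow> a' \<in> carrier A \<Longrightarrow> b \<in> carrier B \<Longrightarrow>
    Poly_Mapping.single (a \<oplus>\<^bsub>A\<^esub> a', b) 1 - Poly_Mapping.single (a, b) 1
      - Poly_Mapping.single (a', b) 1 \<in> bilinear_relations A B"
  "a \<in> carrier A \<Longrightarrow> b \<in> carrier B \<Longrightarrow> b' \<in> carrier B \<Longrightarrow>
    Poly_Mapping.single (a, b \<oplus>\<^bsub>B\<^esub> b') 1 - Poly_Mapping.single (a, b) 1
      - Poly_Mapping.single (a, b') 1 \<in> bilinear_relations A B"
  "a \<in> carrier A \<Longrightarrow> b \<in> carrier B \<Longrightarrow>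
    Poly_Mapping.single (c \<odot>\<^bsub>A\<^esub> a, b) 1 - Poly_Mapping.single (a, b) c \<in> bilinear_relations A B"
  "a \<in> carrier A \<Longrightarrow> b \<in> carrier B \<Longrightarrow>
    Poly_Mapping.single (a, c \<odot>\<^bsub>B\<^esub> b) 1 - Poly_Mapping.single (a, b) c \<in> bilinear_relations A B"
  unfolding bilinear_relations_def
  by (rule UnI1, rule UnI1, rule UnI1, intro CollectI exI conjI, rule refl, assumption+)
    (rule UnI1, rule UnI1, rule UnI2, intro CollectI exI conjI, rule refl, assumption+,
      rule UnI1, rule UnI2, intro CollectI exI conjI, rule refl, assumption+,
      rule UnI2, intro CollectI exI conjI, rule refl, assumption+)

text \<open>One closure rule covers sums and scalar multiples: take \<open>c = 1\<close> for the
  former and \<open>y = 0\<close> for the latter.\<close>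

lemma tensor_kernel_induct [consumes 1, case_names zero step base]:
  assumes "x \<in> K" "P 0" "\<And>c x y. P x \<Longrightarrow> P y \<Longrightarrow> P (scale c x + y)"
    "\<And>x. x \<in> bilinear_relations A B \<Longrightarrow> P x"
  shows "P x"
proof -
  have "sc.subspace (Collect P)"
    unfolding sc.subspace_def mem_Collect_eq
    using assms(2) assms(3)[where c = 1] assms(3)[where y = 0] by simp
  then show ?thesis
    using sc.span_induct[OF assms(1)[unfolded tensor_kernel_def], of P] assms(4) by blast
qed

lemma tensor_kernel_simps:
  "0 \<in> K" "x \<in> K \<Longrightarrow> y \<in> K \<Longrightarrow> x + y \<in> K" "x \<in> K \<Longrightarrow> scale c x \<in> K" "x \<in> K \<Longrightarrow> - x \<in> K"
  "x \<in> bilinear_relations A B \<Longrightarrow> x \<in> K"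
  unfolding tensor_kernel_def
  by (simp_all add: sc.span_zero sc.span_add sc.span_scale sc.span_neg sc.span_base)

lemma tensor_kernel_carrier:
  assumes "x \<in> K"
  shows "Poly_Mapping.keys x \<subseteq> carrier A \<times> carrier B"
  using assms
proof (induction x rule: tensor_kernel_induct)
  case (step c x y)
  then show ?case using keys_add[of "scale c x" y] keys_scale[of c x] by auto
next
  case (base r)
  have diff: "x - y \<in> carrier F" if "x \<in> carrier F" "y \<in> carrier F" for x y
    using keys_diff[of x y] that by auto
  from base have "r \<in> carrier F"
    by (cases rule: bilinear_relations_cases; simp only:) (intro diff; simp)+
  then show ?case by simp
qed simp

text \<open>Multiplying a bilinear relation by a monomial on either side gives a bilinear relation
  of the same kind.\<close>

lemma tensor_kernel_mult_single:
  assumes "x \<in> K" "a0 \<in> carrier A" "b0 \<in> carrier B"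
  shows "Poly_Mapping.single (a0, b0) 1 \<otimes>\<^bsub>F\<^esub> x \<in> K" "x \<otimes>\<^bsub>F\<^esub> Poly_Mapping.single (a0, b0) 1 \<in> K"
proof -
  let ?s = "Poly_Mapping.single (a0, b0) 1"
  have "?s \<otimes>\<^bsub>F\<^esub> x \<in> K \<and> x \<otimes>\<^bsub>F\<^esub> ?s \<in> K"
    using assms(1)
  proof (induction x rule: tensor_kernel_induct)
    case zero
    then show ?case by (simp add: tensor_kernel_simps)
  next
    case (step c x y)
    then show ?case
      by (simp add: monoid_algebra_mult_add_left monoid_algebra_mult_add_right
          monoid_algebra_mult_scale_left monoid_algebra_mult_scale_right tensor_kernel_simps)
  next
    case (base r)
    have "?s \<otimes>\<^bsub>F\<^esub> r \<in> bilinear_relations A B \<and> r \<otimes>\<^bsub>F\<^esub> ?s \<in> bilinear_relations A B"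
      using base
    proof (cases rule: bilinear_relations_cases)
      case (add_left a a' b)
      then show ?thesis
        using assms(2,3) bilinear_relationsI(1)[of "a0 \<otimes>\<^bsub>A\<^esub> a" "a0 \<otimes>\<^bsub>A\<^esub> a'" "b0 \<otimes>\<^bsub>B\<^esub> b"]
          bilinear_relationsI(1)[of "a \<otimes>\<^bsub>A\<^esub> a0" "a' \<otimes>\<^bsub>A\<^esub> a0" "b \<otimes>\<^bsub>B\<^esub> b0"]
        by (simp add: monoid_algebra_mult_diff A.l_distr A.r_distr)
    next
      case (add_right a b b')
      then show ?thesis
        using assms(2,3) bilinear_relationsI(2)[of "a0 \<otimes>\<^bsub>A\<^esub> a" "b0 \<otimes>\<^bsub>B\<^esub> b" "b0 \<otimes>\<^bsub>B\<^esub> b'"]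
          bilinear_relationsI(2)[of "a \<otimes>\<^bsub>A\<^esub> a0" "b \<otimes>\<^bsub>B\<^esub> b0" "b' \<otimes>\<^bsub>B\<^esub> b0"]
        by (simp add: monoid_algebra_mult_diff B.l_distr B.r_distr)
    next
      case (smult_left c a b)
      then show ?thesis
        using assms(2,3) bilinear_relationsI(3)[of "a0 \<otimes>\<^bsub>A\<^esub> a" "b0 \<otimes>\<^bsub>B\<^esub> b" c]
          bilinear_relationsI(3)[of "a \<otimes>\<^bsub>A\<^esub> a0" "b \<otimes>\<^bsub>B\<^esub> b0" c]
        by (simp add: monoid_algebra_mult_diff A.mult_smult_left A.mult_smult_right)
    next
      case (smult_right c a b)
      then show ?thesis
        using assms(2,3) bilinear_relationsI(4)[of "a0 \<otimes>\<^bsub>A\<^esub> a" "b0 \<otimes>\<^bsub>B\<^esub> b" c]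
          bilinear_relationsI(4)[of "a \<otimes>\<^bsub>A\<^esub> a0" "b \<otimes>\<^bsub>B\<^esub> b0" c]
        by (simp add: monoid_algebra_mult_diff B.mult_smult_left B.mult_smult_right)
    qed
    then show ?case by (simp add: tensor_kernel_simps)
  qed
  then show "?s \<otimes>\<^bsub>F\<^esub> x \<in> K" "x \<otimes>\<^bsub>F\<^esub> ?s \<in> K" by auto
qed

text \<open>By linearity in \<open>y\<close> the case of a monomial suffices. This makes
  \<open>K\<close> a two-sided ideal, so the tensor product inherits the componentwise
  multiplication.\<close>

lemma tensor_kernel_mult:
  assumes "x \<in> K" "Poly_Mapping.keys y \<subseteq> carrier A \<times> carrier B"
  shows "y \<otimes>\<^bsub>F\<^esub> x \<in> K \<and> x \<otimes>\<^bsub>F\<^esub> y \<in> K"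
  using assms(2)
proof (induction y rule: poly_mapping_keys_induct)
  case zero
  then show ?case by (simp add: tensor_kernel_simps)
next
  case (single_add p c y)
  obtain a b where p: "p = (a, b)" "a \<in> carrier A" "b \<in> carrier B" using single_add by auto
  have "Poly_Mapping.single p c = scale c (Poly_Mapping.single (a, b) 1)"
    using p by simp
  then show ?case
    using single_add tensor_kernel_mult_single[OF assms(1) p(2,3)]
    by (simp add: monoid_algebra_mult_add_left monoid_algebra_mult_add_right tensor_kernel_simps
        monoid_algebra_mult_scale_left monoid_algebra_mult_scale_right del: scale_single)
qed

sublocale T: algebra_ideal F K
proof -
  have K: "K \<subseteq> carrier F"
    using tensor_kernel_carrier by auto
  have "subgroup K (add_monoid F)"
  proof (rule F.add.subgroupI)
    show "K \<subseteq> carrier F" by fact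
    show "K \<noteq> {}" using tensor_kernel_simps(1) by blast
    fix x y assume xy: "x \<in> K" "y \<in> K"
    show "x \<oplus>\<^bsub>F\<^esub> y \<in> K" using xy by (simp add: tensor_kernel_simps)
    show "\<ominus>\<^bsub>F\<^esub> x \<in> K"
      using monoid_algebra_a_inv[OF DirProd_monoid' subsetD[OF K xy(1)]] xy
      by (simp only: tensor_kernel_simps)
  qed
  then have "ideal K F"
    using tensor_kernel_mult by (intro idealI F.ring_axioms) simp_all
  then show "algebra_ideal F K"
    by (intro algebra_ideal.intro F.assoc_algebra_axioms)
qed

lemma tensor_algebra: "assoc_algebra (tensor A B)"
  unfolding tensor_def by (rule T.quotient_algebra)

lemma pure_tensor_closed [simp, intro]:
  "a \<in> carrier A \<Longrightarrow> b \<in> carrier B \<Longrightarrow> pure_tensor A B a b \<in> carrier (tensor A B)"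
  unfolding pure_tensor_def tensor_def by auto

lemma pure_tensor_one: "\<one>\<^bsub>tensor A B\<^esub> = pure_tensor A B \<one>\<^bsub>A\<^esub> \<one>\<^bsub>B\<^esub>"
  unfolding pure_tensor_def tensor_def by (simp add: T.quotient_simps)

lemma pure_tensor_mult:
  assumes "a \<in> carrier A" "b \<in> carrier B" "a' \<in> carrier A" "b' \<in> carrier B"
  shows "pure_tensor A B a b \<otimes>\<^bsub>tensor A B\<^esub> pure_tensor A B a' b' =
    pure_tensor A B (a \<otimes>\<^bsub>A\<^esub> a') (b \<otimes>\<^bsub>B\<^esub> b')"
  using assms unfolding pure_tensor_def tensor_def by (simp add: T.quotient_simps)

lemma coset_eqI:
  assumes "f - g \<in> K" "Poly_Mapping.keys f \<subseteq> carrier A \<times> carrier B"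
    "Poly_Mapping.keys g \<subseteq> carrier A \<times> carrier B"
  shows "K +>\<^bsub>F\<^esub> f = K +>\<^bsub>F\<^esub> g"
  using assms by (subst T.coset_eq_iff) (simp_all add: monoid_algebra_minus[OF DirProd_monoid'])

lemma pure_tensor_add_left:
  assumes "a \<in> carrier A" "a' \<in> carrier A" "b \<in> carrier B"
  shows "pure_tensor A B (a \<oplus>\<^bsub>A\<^esub> a') b =
    pure_tensor A B a b \<oplus>\<^bsub>tensor A B\<^esub> pure_tensor A B a' b"
proof -
  have "Poly_Mapping.keys (Poly_Mapping.single (a, b) 1 + Poly_Mapping.single (a', b) 1 :: _ \<Rightarrow>\<^sub>0 'k)
    \<subseteq> carrier A \<times> carrier B"
    using keys_add assms by (fastforce split: if_splits)
  then show ?thesis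
    using assms bilinear_relationsI(1)[OF assms] unfolding pure_tensor_def tensor_def
    by (simp add: T.quotient_simps)
      (intro coset_eqI tensor_kernel_simps(5), simp_all add: algebra_simps)
qed

lemma pure_tensor_add_right:
  assumes "a \<in> carrier A" "b \<in> carrier B" "b' \<in> carrier B"
  shows "pure_tensor A B a (b \<oplus>\<^bsub>B\<^esub> b') =
    pure_tensor A B a b \<oplus>\<^bsub>tensor A B\<^esub> pure_tensor A B a b'"
proof -
  have "Poly_Mapping.keys (Poly_Mapping.single (a, b) 1 + Poly_Mapping.single (a, b') 1 :: _ \<Rightarrow>\<^sub>0 'k)
    \<subseteq> carrier A \<times> carrier B"
    using keys_add assms by (fastforce split: if_splits)
  then show ?thesis
    using assms bilinear_relationsI(2)[OF assms] unfolding pure_tensor_def tensor_def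
    by (simp add: T.quotient_simps)
      (intro coset_eqI tensor_kernel_simps(5), simp_all add: algebra_simps)
qed

lemma pure_tensor_zero:
  assumes "a \<in> carrier A" "b \<in> carrier B"
  shows "pure_tensor A B \<zero>\<^bsub>A\<^esub> b = \<zero>\<^bsub>tensor A B\<^esub>" "pure_tensor A B a \<zero>\<^bsub>B\<^esub> = \<zero>\<^bsub>tensor A B\<^esub>"
proof -
  interpret TA: assoc_algebra "tensor A B" by (rule tensor_algebra)
  \<comment> \<open>Since 0 + 0 = 0, additivity makes this tensor equal to its own double, so it
    vanishes.\<close>
  show "pure_tensor A B \<zero>\<^bsub>A\<^esub> b = \<zero>\<^bsub>tensor A B\<^esub>"
    using pure_tensor_add_left[of "\<zero>\<^bsub>A\<^esub>" "\<zero>\<^bsub>A\<^esub>" b] assms TA.add.l_cancel_one by simp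
  show "pure_tensor A B a \<zero>\<^bsub>B\<^esub> = \<zero>\<^bsub>tensor A B\<^esub>"
    using pure_tensor_add_right[of a "\<zero>\<^bsub>B\<^esub>" "\<zero>\<^bsub>B\<^esub>"] assms TA.add.l_cancel_one by simp
qed

text \<open>This is the well-definedness of the form on the tensor product: the product of the
  values is bilinear, so each of the four families of relations is sent to zero.\<close>

lemma tensor_form_coset:
  assumes f: "f \<in> linear_forms A" and g: "g \<in> linear_forms B"
    and x: "Poly_Mapping.keys x \<subseteq> carrier A \<times> carrier B"
  shows "tensor_form f g (K +>\<^bsub>F\<^esub> x) = linear_ext scalars (\<lambda>(a, b). f a * g b) x"
proof -
  interpret S: assoc_algebra "scalars :: ('k, 'k) module" by (rule scalars_algebra)
  let ?\<phi> = "\<lambda>(a, b). f a * g b"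
  have \<phi>: "?\<phi> \<in> X \<rightarrow> carrier scalars" for X by auto
  have single: "linear_ext scalars ?\<phi> (Poly_Mapping.single (a, b) c) = c * (f a * g b)" for a b c
    by (subst S.linear_ext_single) auto
  have minus: "linear_ext scalars ?\<phi> (x - y) = linear_ext scalars ?\<phi> x - linear_ext scalars ?\<phi> y" for x y
  proof -
    have "linear_ext scalars ?\<phi> (x - y + y) = linear_ext scalars ?\<phi> (x - y) \<oplus>\<^bsub>scalars\<^esub> linear_ext scalars ?\<phi> y"
      using S.linear_ext_add[OF subset_UNIV subset_UNIV \<phi>] .
    then show ?thesis by (simp add: algebra_simps)
  qed
  have "linear_ext scalars ?\<phi> i = 0" if "i \<in> K" for i
    using that
  proof (induction i rule: tensor_kernel_induct)
    case zero
    show ?case using S.linear_ext_zero[of ?\<phi>] by simp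
  next
    case (step c x y)
    then show ?case
      using S.linear_ext_add[OF subset_UNIV subset_UNIV \<phi>, of "scale c x" y]
        S.linear_ext_scale[OF subset_UNIV \<phi>, of c x] by simp
  next
    case (base r)
    have fl: "f (a \<oplus>\<^bsub>A\<^esub> a') = f a + f a'" "f (c \<odot>\<^bsub>A\<^esub> a) = c * f a"
      if "a \<in> carrier A" "a' \<in> carrier A" for a a' c
      using f that by (simp_all add: linear_forms_def)
    have gl: "g (b \<oplus>\<^bsub>B\<^esub> b') = g b + g b'" "g (c \<odot>\<^bsub>B\<^esub> b) = c * g b"
      if "b \<in> carrier B" "b' \<in> carrier B" for b b' c
      using g that by (simp_all add: linear_forms_def)
    from base show ?case
      by (cases rule: bilinear_relations_cases)
        (simp_all add: minus single fl gl distrib_left distrib_right mult.assoc mult.left_commute)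
  qed
  then show ?thesis
    unfolding tensor_form_def using x scalars_algebra
    by (intro induced_coset DirProd_monoid' \<phi> T.is_additive_subgroup) auto
qed

lemma tensor_form_pure:
  assumes "f \<in> linear_forms A" "g \<in> linear_forms B" "a \<in> carrier A" "b \<in> carrier B"
  shows "tensor_form f g (pure_tensor A B a b) = f a * g b"
proof -
  interpret S: assoc_algebra "scalars :: ('k, 'k) module" by (rule scalars_algebra)
  show ?thesis
    using assms by (simp add: pure_tensor_def tensor_form_coset)
qed

lemma tensor_form_linear:
  assumes "f \<in> linear_forms A" "g \<in> linear_forms B" "x \<in> carrier (tensor A B)" "y \<in> carrier (tensor A B)"
  shows "tensor_form f g (x \<oplus>\<^bsub>tensor A B\<^esub> y) = tensor_form f g x + tensor_form f g y"
    and "tensor_form f g (c \<odot>\<^bsub>tensor A B\<^esub> x) = c * tensor_form f g x"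
proof -
  interpret S: assoc_algebra "scalars :: ('k, 'k) module" by (rule scalars_algebra)
  let ?\<phi> = "\<lambda>(a, b). f a * g b"
  have \<phi>: "?\<phi> \<in> X \<rightarrow> carrier scalars" for X by auto
  obtain x' y' where xy: "x = K +>\<^bsub>F\<^esub> x'" "y = K +>\<^bsub>F\<^esub> y'"
    "Poly_Mapping.keys x' \<subseteq> carrier A \<times> carrier B" "Poly_Mapping.keys y' \<subseteq> carrier A \<times> carrier B"
    using assms(3,4) by (auto simp: tensor_def T.quotient_carrier)
  have k: "Poly_Mapping.keys (x' + y') \<subseteq> carrier A \<times> carrier B"
    "Poly_Mapping.keys (scale c x') \<subseteq> carrier A \<times> carrier B"
    using keys_add[of x' y'] keys_scale[of c x'] xy by auto
  show "tensor_form f g (x \<oplus>\<^bsub>tensor A B\<^esub> y) = tensor_form f g x + tensor_form f g y"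
    using xy k S.linear_ext_add[OF subset_UNIV subset_UNIV \<phi>, of x' y']
    by (simp add: tensor_def T.quotient_simps tensor_form_coset assms(1,2))
  show "tensor_form f g (c \<odot>\<^bsub>tensor A B\<^esub> x) = c * tensor_form f g x"
    using xy k S.linear_ext_scale[OF subset_UNIV \<phi>, of c x']
    by (simp add: tensor_def T.quotient_smult tensor_form_coset assms(1,2))
qed

end

subsection \<open>Words in two letters\<close>

text \<open>Unfolding gives the alternating sum \<open>r\<close> of the overview, with positions
  counted from 0 and \<open>True\<close> standing for \<open>b\<close>. The sign flips at every
  letter because each letter inverts the power of \<open>\<rho>\<close> to its right.\<close>

fun rot :: "bool list \<Rightarrow> int" where
  "rot [] = 0"
| "rot (\<beta> # u) = of_bool \<beta> - rot u"

lemma alternating_Suc: "alternating (Suc n) a b = a # alternating n b a"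
  unfolding alternating_def by (simp add: upt_conv_Cons flip: map_Suc_upt del: upt_Suc)

lemma length_alternating [simp]: "length (alternating n a b) = n"
  by (simp add: alternating_def)

lemma map_alternating: "map f (alternating n a b) = alternating n (f a) (f b)"
  by (simp add: alternating_def)

text \<open>The two formulas are proved together, as removing the first letter exchanges the two
  words. For even \<open>n\<close> the values are opposite, so the alternating relation becomes a
  condition on a power of \<open>\<rho>\<close>.\<close>

lemma rot_alternating:
  "rot (alternating n False True) = - int (n div 2)"
  "rot (alternating n True False) = int (Suc n div 2)"
proof (induction n)
  case 0
  {
    case 1 show ?case by (simp add: alternating_def)
  next
    case 2 show ?case by (simp add: alternating_def)
  }
next
  case (Suc n)
  {
    case 1 show ?case by (simp add: alternating_Suc Suc)
  next
    case 2 show ?case by (simp add: alternating_Suc Suc)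
  }
qed

lemma rot_replicate_False [simp]: "rot (replicate m False) = 0"
  by (induction m) auto

text \<open>The alternating sum of ones over all positions is the parity of the length; replacing
  each letter by its complement subtracts from it.\<close>

lemma rot_map_Not: "rot (map Not u) = of_bool (odd (length u)) - rot u"
  by (induction u) auto

context group
begin

lemma int_pow_mod:
  assumes "x \<in> carrier G" "x [^] (m :: nat) = \<one>" "(i :: int) mod int m = j mod int m"
  shows "x [^] i = x [^] j"
proof -
  obtain k where "i - j = int m * k" using assms(3) by (metis dvdE mod_eq_dvd_iff)
  then have i: "i = j + int m * k" by simp
  have "x [^] (int m * k) = \<one>"
    using assms(1,2) by (metis int_pow_int int_pow_one int_pow_pow)
  then show ?thesis using assms(1) unfolding i by (simp add: int_pow_mult)
qed

text \<open>With \<open>\<rho> = b a\<^sup>-\<^sup>1\<close> one has \<open>a \<rho> = \<rho>\<^sup>-\<^sup>1 a\<close> and \<open>b = \<rho> a\<close>, so that powers of \<open>\<rho>\<close> can be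
  collected on the left.\<close>

lemma word_value_rot:
  assumes a: "a \<in> carrier G" and b: "b \<in> carrier G" and sq: "b \<otimes> b = a \<otimes> a"
  shows "word_value G (\<lambda>\<beta>. if \<beta> then b else a) u = (b \<otimes> inv a) [^] rot u \<otimes> a [^] length u"
proof -
  define \<rho> where "\<rho> = b \<otimes> inv a"
  have \<rho>: "\<rho> \<in> carrier G" using a b by (simp add: \<rho>_def)
  have "\<rho> \<otimes> a \<otimes> \<rho> = b \<otimes> b \<otimes> inv a" using a b by (simp add: \<rho>_def m_assoc)
  also have "\<dots> = a" using a b by (simp add: sq m_assoc)
  finally have aba: "\<rho> \<otimes> a \<otimes> \<rho> = a" .
  then have a\<rho>: "a \<otimes> \<rho> = inv \<rho> \<otimes> a" using a \<rho> by (metis inv_solve_left' m_assoc m_closed)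
  have comm_nat: "a \<otimes> \<rho> [^] (k :: nat) = inv \<rho> [^] k \<otimes> a" for k
  proof (induction k)
    case 0
    show ?case using a by simp
  next
    case (Suc k)
    have "a \<otimes> \<rho> [^] Suc k = a \<otimes> \<rho> [^] k \<otimes> \<rho>" using a \<rho> by (simp add: m_assoc)
    also have "\<dots> = inv \<rho> [^] k \<otimes> (a \<otimes> \<rho>)" using Suc a \<rho> by (simp add: m_assoc)
    also have "\<dots> = inv \<rho> [^] Suc k \<otimes> a" using a \<rho> by (simp add: a\<rho> m_assoc)
    finally show ?case .
  qed
  have comm: "a \<otimes> \<rho> [^] (i :: int) = \<rho> [^] (- i) \<otimes> a" for i
  proof (cases i)
    case (nonneg k)
    then show ?thesis using comm_nat[of k] \<rho> by (simp add: int_pow_int int_pow_neg nat_pow_inv)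
  next
    case (neg k)
    have P: "\<rho> [^] Suc k \<in> carrier G" using \<rho> by (rule nat_pow_closed)
    have "a \<otimes> \<rho> [^] Suc k = inv (\<rho> [^] Suc k) \<otimes> a"
      using comm_nat[of "Suc k"] \<rho> by (simp only: nat_pow_inv)
    \<comment> \<open>With \<open>P\<close> the positive power, \<open>P a P = a\<close> can be
      solved for \<open>a P^-1\<close> as well as for \<open>a P\<close>, which settles negative
      exponents.\<close>
    then have "\<rho> [^] Suc k \<otimes> (a \<otimes> \<rho> [^] Suc k) = a"
      using a P by (metis inv_closed l_one m_assoc r_inv)
    then have "a \<otimes> inv (\<rho> [^] Suc k) = \<rho> [^] Suc k \<otimes> a"
      using a \<rho> by (metis inv_solve_right m_assoc m_closed nat_pow_closed)
    then show ?thesis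
      using neg \<rho> by (simp add: int_pow_neg int_pow_int del: nat_pow_Suc of_nat_Suc)
  qed
  have "word_value G (\<lambda>\<beta>. if \<beta> then b else a) u = \<rho> [^] rot u \<otimes> a [^] length u"
  proof (induction u)
    case Nil
    show ?case by simp
  next
    case (Cons \<beta> u)
    have *: "a \<otimes> (\<rho> [^] rot u \<otimes> a [^] length u) = \<rho> [^] (- rot u) \<otimes> a [^] Suc (length u)"
    proof -
      have "a \<otimes> (\<rho> [^] rot u \<otimes> a [^] length u) = (\<rho> [^] (- rot u) \<otimes> a) \<otimes> a [^] length u"
        using a \<rho> by (simp add: comm flip: m_assoc)
      also have "\<dots> = \<rho> [^] (- rot u) \<otimes> (a [^] length u \<otimes> a)"
        using a \<rho> by (simp add: m_assoc flip: nat_pow_Suc2 del: nat_pow_Suc)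
      finally show ?thesis by simp
    qed
    show ?case
    proof (cases \<beta>)
      case True
      have "b = \<rho> \<otimes> a" using a b by (simp add: \<rho>_def m_assoc)
      then have "b \<otimes> (\<rho> [^] rot u \<otimes> a [^] length u) =
          \<rho> \<otimes> (\<rho> [^] (- rot u) \<otimes> a [^] Suc (length u))"
        using a \<rho> * by (simp add: m_assoc del: nat_pow_Suc)
      also have "\<dots> = \<rho> [^] (1 - rot u) \<otimes> a [^] Suc (length u)"
        using a \<rho> int_pow_mult[OF \<rho>, of 1 "- rot u"]
        by (simp add: int_pow_1 m_assoc del: nat_pow_Suc)
      finally show ?thesis using True Cons by simp
    next
      case False
      then show ?thesis using Cons * by simp
    qed
  qed
  then show ?thesis by (simp add: \<rho>_def)
qed

text \<open>In the normal form of \<open>word_value_rot\<close>, the unit relation says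
  \<open>a^(2N) = 1\<close>, and for even \<open>n\<close> the alternating relation gives
  \<open>\<rho>^n = 1\<close>. Hence only the residues of the two exponents matter.\<close>

lemma word_value_eq:
  fixes a b N n
  defines "v \<equiv> \<lambda>\<beta>. if \<beta> then b else a"
  assumes a: "a \<in> carrier G" and b: "b \<in> carrier G" and sq: "b \<otimes> b = a \<otimes> a"
    and one: "word_value G v (replicate (2 * N) False) = \<one>"
    and alt: "word_value G v (alternating n False True) = word_value G v (alternating n True False)"
    and "even n"
    and len: "int (length u) mod int (2 * N) = int (length w) mod int (2 * N)"
    and rot: "rot u mod int n = rot w mod int n"
  shows "word_value G v u = word_value G v w"
proof -
  note wv = word_value_rot[OF a b sq, folded v_def]
  let ?\<rho> = "b \<otimes> inv a"
  have \<rho>: "?\<rho> \<in> carrier G" using a b by simp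
  obtain m where n: "n = 2 * m" using \<open>even n\<close> by blast
  \<comment> \<open>Both alternating words have length \<open>n\<close>, so the same power of
    \<open>a\<close> cancels on the right.\<close>
  have "?\<rho> [^] (- int m) = ?\<rho> [^] int m"
    using alt a \<rho> by (simp add: wv rot_alternating n)
  then have "?\<rho> [^] int m \<otimes> ?\<rho> [^] int m = \<one>"
    using \<rho> by (metis int_pow_closed int_pow_neg r_inv)
  then have "?\<rho> [^] n = \<one>"
    using \<rho> by (simp add: n mult_2 nat_pow_mult int_pow_int)
  then have "?\<rho> [^] rot u = ?\<rho> [^] rot w"
    using \<rho> rot by (intro int_pow_mod)
  moreover have "a [^] int (length u) = a [^] int (length w)"
    using a one len by (intro int_pow_mod[of _ "2 * N"]) (simp_all add: wv)
  ultimately show ?thesis by (simp add: wv int_pow_int)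
qed

end

subsection \<open>Representations of Suzuki's algebra\<close>

text \<open>The generators of type \<open>False\<close> are \<open>x\<^sub>1\<^sub>1, x\<^sub>2\<^sub>2\<close>, those of type \<open>True\<close> are \<open>x\<^sub>1\<^sub>2, x\<^sub>2\<^sub>1\<close>.\<close>

definition letter :: "bool \<Rightarrow> bool \<Rightarrow> gen" where
  "letter c \<beta> = (if \<beta> then 2 else 1, if \<beta> = c then 1 else 2)"

definition typed :: "bool \<Rightarrow> bool list \<Rightarrow> gen list" where
  "typed c u = map (letter c) u"

lemma letter_gens [simp]: "letter c \<beta> \<in> suzuki_gens"
  by (simp add: letter_def suzuki_gens_def)

lemma letter_cases:
  assumes "g \<in> suzuki_gens"
  obtains c \<beta> where "g = letter c \<beta>"
proof -
  have "g = letter (fst g \<noteq> snd g) (fst g = 2)"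
    using assms by (auto simp: suzuki_gens_def letter_def)
  then show ?thesis using that by blast
qed

text \<open>Translates the parity condition in \<open>suzuki_relations\<close> into a comparison of
  types.\<close>

lemma letter_parity:
  assumes "(i, j) = letter c \<beta>"
  shows "(int i - int j) mod 2 = of_bool c"
  using assms by (cases c; cases \<beta>) (simp_all add: letter_def)

lemma typed_simps [simp]:
  "typed c [] = []" "typed c (\<beta> # u) = letter c \<beta> # typed c u" "typed c (u @ w) = typed c u @ typed c w"
  by (simp_all add: typed_def)

lemma typed_lists [simp]: "typed c u \<in> lists suzuki_gens"
  by (induction u) auto

text \<open>The relations are rewritten uniformly in the type. For type \<open>True\<close> the
  defining relation begins with \<open>x\<^sub>2\<^sub>1\<close>, the letter \<open>True\<close>, so
  the order of the letters in the alternating words depends on \<open>c\<close>.\<close>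

lemma suzuki_relations_cases [consumes 1, case_names square mixed unit alternating]:
  assumes "r \<in> suzuki_relations N n (1 :: 'k::field) 1"
  obtains
    c where "r = word (typed c [False, False]) - word (typed c [True, True])"
  | c \<beta> \<beta>' where "r = word [letter c \<beta>, letter (\<not> c) \<beta>']"
  | "r = word (typed False (replicate (2 * N) False)) + word (typed True (replicate (2 * N) False))
      - word []"
  | c where "r = word (typed c (alternating n c (\<not> c))) - word (typed c (alternating n (\<not> c) c))"
proof -
  have letters: "letter False False = (1, 1)" "letter False True = (2, 2)"
    "letter True False = (1, 2)" "letter True True = (2, 1)"
    by (simp_all add: letter_def)
  consider
    "r = word [(1,1), (1,1)] - word [(2,2), (2,2)]" | "r = word [(1,2), (1,2)] - word [(2,1), (2,1)]"
  | (mixed) i j l m where "r = word [(i,j), (l,m)]" "(i,j) \<in> suzuki_gens" "(l,m) \<in> suzuki_gens"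
      "(int i - int j) mod 2 \<noteq> (int l - int m) mod 2"
  | "r = word (replicate (2 * N) (1,1)) + scale 1 (word (replicate (2 * N) (1,2))) - word []"
  | "r = word (alternating n (1,1) (2,2)) - word (alternating n (2,2) (1,1))"
  | "r = word (alternating n (2,1) (1,2)) - scale 1 (word (alternating n (1,2) (2,1)))"
    using assms unfolding suzuki_relations_def by auto
  then show ?thesis
  proof cases
    case 1
    then show ?thesis using that(1)[of False] by (simp add: letters)
  next
    case 2
    then show ?thesis using that(1)[of True] by (simp add: letters)
  next
    case mixed
    obtain c \<beta> c' \<beta>' where eq: "(i, j) = letter c \<beta>" "(l, m) = letter c' \<beta>'"
      using mixed by (metis letter_cases)
    then have "c' = (\<not> c)" using mixed letter_parity[OF eq(1)] letter_parity[OF eq(2)] by auto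
    then show ?thesis using that(2)[of c \<beta> \<beta>'] mixed eq by simp
  next
    case 4
    then show ?thesis using that(3) by (simp add: typed_def letters)
  next
    case 5
    then show ?thesis using that(4)[of False] by (simp add: typed_def map_alternating letters)
  next
    case 6
    then show ?thesis using that(4)[of True] by (simp add: typed_def map_alternating letters)
  qed
qed

lemma suzuki_relations_mem:
  "word (typed c [False, False]) - word (typed c [True, True]) \<in> suzuki_relations N n (1 :: 'k::field) 1"
  "word [letter c \<beta>, letter (\<not> c) \<beta>'] \<in> suzuki_relations N n (1 :: 'k) 1"
  "word (typed False (replicate (2 * N) False)) + word (typed True (replicate (2 * N) False)) - word []
    \<in> suzuki_relations N n (1 :: 'k) 1"
  "word (typed c (alternating n c (\<not> c))) - word (typed c (alternating n (\<not> c) c))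
    \<in> suzuki_relations N n (1 :: 'k) 1"
proof -
  have letters: "letter False False = (1, 1)" "letter False True = (2, 2)"
    "letter True False = (1, 2)" "letter True True = (2, 1)"
    by (simp_all add: letter_def)
  show "word (typed c [False, False]) - word (typed c [True, True]) \<in> suzuki_relations N n (1 :: 'k) 1"
    by (cases c) (simp_all add: letters suzuki_relations_def)
  obtain i j l m where eq: "letter c \<beta> = (i, j)" "letter (\<not> c) \<beta>' = (l, m)" by fastforce
  then have "(int i - int j) mod 2 \<noteq> (int l - int m) mod 2"
    using letter_parity[OF eq(1)[symmetric]] letter_parity[OF eq(2)[symmetric]] by auto
  moreover have "(i, j) \<in> suzuki_gens" "(l, m) \<in> suzuki_gens"
    using letter_gens[of c \<beta>] letter_gens[of "\<not> c" \<beta>'] eq by auto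
  ultimately show "word [letter c \<beta>, letter (\<not> c) \<beta>'] \<in> suzuki_relations N n (1 :: 'k) 1"
    unfolding suzuki_relations_def eq by blast
  show "word (typed False (replicate (2 * N) False)) + word (typed True (replicate (2 * N) False)) - word []
    \<in> suzuki_relations N n (1 :: 'k) 1"
    by (simp add: typed_def letters suzuki_relations_def)
  show "word (typed c (alternating n c (\<not> c))) - word (typed c (alternating n (\<not> c) c))
    \<in> suzuki_relations N n (1 :: 'k) 1"
    by (cases c) (simp_all add: typed_def map_alternating letters suzuki_relations_def)
qed

text \<open>\<open>kt\<close> records the ground field, which \<open>N\<close> and \<open>n\<close>
  do not determine. Both signs of the presentation are fixed to 1 throughout.\<close>

locale suzuki =
  fixes N n :: nat and kt :: "'k::field itself"
  assumes N: "N \<ge> 1" and n: "n \<ge> 2" and even_n: "even n"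
begin

lemma alternating_not_Nil: "alternating n a b \<noteq> []"
  using n length_alternating[of n a b] by (metis list.size(3) not_numeral_le_zero)

abbreviation "X \<equiv> suzuki_gens"
abbreviation Rel :: "(gen list \<Rightarrow>\<^sub>0 'k) set" where "Rel \<equiv> suzuki_relations N n 1 1"
abbreviation I :: "(gen list \<Rightarrow>\<^sub>0 'k) set" where "I \<equiv> suzuki_ideal N n 1 1"
abbreviation Alg :: "('k, (gen list \<Rightarrow>\<^sub>0 'k) set) module" where "Alg \<equiv> suzuki_algebra N n 1 1"
abbreviation x :: "gen \<Rightarrow> (gen list \<Rightarrow>\<^sub>0 'k) set" where "x \<equiv> suzuki_x N n 1 1"
abbreviation Free :: "('k, gen list \<Rightarrow>\<^sub>0 'k) module" where "Free \<equiv> free_algebra X"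

lemma word_carrier: "w \<in> lists X \<Longrightarrow> word w \<in> carrier Free"
  by (simp add: free_algebra_def)

lemma Rel_carrier: "Rel \<subseteq> carrier Free"
proof
  fix r assume "r \<in> Rel"
  have closed: "f + g \<in> carrier Free" "f - g \<in> carrier Free"
    if "f \<in> carrier Free" "g \<in> carrier Free" for f g
    using that keys_add[of f g] keys_diff[of f g] by (auto simp: free_algebra_def)
  show "r \<in> carrier Free"
    using \<open>r \<in> Rel\<close>
    by (cases rule: suzuki_relations_cases; simp only:)
      (intro closed word_carrier; (rule typed_lists | simp))+
qed

sublocale P: algebra_ideal Free I
  unfolding suzuki_ideal_def by (rule genideal_free_algebra[OF Rel_carrier])

lemma Rel_I: "Rel \<subseteq> I"
  unfolding suzuki_ideal_def by (rule P.genideal_self[OF Rel_carrier])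

sublocale Alg: assoc_algebra Alg
  unfolding suzuki_algebra_def by (rule P.quotient_algebra)

lemma Alg_one: "\<one>\<^bsub>Alg\<^esub> = I +>\<^bsub>Free\<^esub> word []"
  unfolding suzuki_algebra_def P.quotient_simps by (simp add: free_algebra_def)

lemma word_value_Alg:
  assumes "w \<in> lists X"
  shows "word_value Alg x w = I +>\<^bsub>Free\<^esub> word w"
  using assms
proof (induction w)
  case Nil
  show ?case by (simp add: Alg_one)
next
  case (Cons g w)
  have "word [g] \<in> carrier Free" "word w \<in> carrier Free"
    using Cons by (auto intro!: word_carrier simp del: in_lists_conv_set)
  then have "x g \<otimes>\<^bsub>Alg\<^esub> (I +>\<^bsub>Free\<^esub> word w) = I +>\<^bsub>Free\<^esub> (word [g] \<otimes>\<^bsub>Free\<^esub> word w)"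
    by (simp add: suzuki_x_def suzuki_algebra_def P.quotient_simps)
  then show ?case using Cons by (simp add: free_algebra_def)
qed

lemma coset_word_eq:
  assumes "word u - word w \<in> Rel" "u \<in> lists X" "w \<in> lists X"
  shows "I +>\<^bsub>Free\<^esub> word u = I +>\<^bsub>Free\<^esub> word w"
proof -
  have "word u \<ominus>\<^bsub>Free\<^esub> word w = word u - word w"
    using word_carrier[OF assms(2)] word_carrier[OF assms(3)]
    unfolding free_algebra_def by (intro monoid_algebra_minus free_monoid)
  then show ?thesis
    using assms Rel_I word_carrier by (subst P.coset_eq_iff) auto
qed

end

text \<open>Such a \<open>v\<close> amounts to an algebra map from the presented algebra to
  \<open>V\<close>. By symmetry of equality, the alternating relation may start with
  \<open>False\<close> on the left for both types.\<close>

locale suzuki_rep = suzuki N n kt + V: assoc_algebra V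
  for N n and kt :: "'k::field itself" and V :: "('k, 'v, 'z) module_scheme" (structure) +
  fixes v :: "gen \<Rightarrow> 'v"
  assumes v_closed: "v \<in> suzuki_gens \<rightarrow> carrier V"
    and mixed: "v (letter c \<beta>) \<otimes> v (letter (\<not> c) \<beta>') = \<zero>"
    and square: "v (letter c True) \<otimes> v (letter c True) = v (letter c False) \<otimes> v (letter c False)"
    and unit: "word_value V v (typed False (replicate (2 * N) False))
      \<oplus> word_value V v (typed True (replicate (2 * N) False)) = \<one>"
    and alt: "word_value V v (typed c (alternating n False True)) =
      word_value V v (typed c (alternating n True False))"
begin

abbreviation wv where "wv \<equiv> word_value V v"
abbreviation tv where "tv c u \<equiv> word_value V v (typed c u)"

lemma wv_closed [simp, intro]: "w \<in> lists X \<Longrightarrow> wv w \<in> carrier V"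
  by (rule V.word_value_closed[OF _ v_closed])

lemma tv_closed [simp, intro]: "tv c u \<in> carrier V"
  by (rule wv_closed[OF typed_lists])

lemma v_letter [simp, intro]: "v (letter c \<beta>) \<in> carrier V"
  using v_closed by (simp add: Pi_iff)

lemma tv_append: "tv c (u @ w) = tv c u \<otimes> tv c w"
  unfolding typed_simps by (rule V.word_value_append[OF typed_lists typed_lists v_closed])

text \<open>Adjacent letters of different types multiply to zero, so only words of a single type
  survive.\<close>

lemma wv_cases:
  assumes "w \<in> lists X"
  obtains c u where "w = typed c u" | "wv w = \<zero>"
proof -
  have "(\<exists>c u. w = typed c u) \<or> wv w = \<zero>"
    using assms
  proof (induction w)
    case Nil
    have "[] = typed False []" by simp
    then show ?case by blast
  next
    case (Cons g w)
    obtain c \<beta> where g: "g = letter c \<beta>" using Cons.hyps letter_cases by blast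
    from Cons.IH show ?case
    proof (elim disjE exE)
      fix c' u assume w: "w = typed c' u"
      show ?thesis
      proof (cases u)
        case Nil
        then have "g # w = typed c [\<beta>]" using g w by simp
        then show ?thesis by blast
      next
        case (Cons \<beta>' u')
        show ?thesis
        proof (cases "c' = c")
          case True
          then have "g # w = typed c (\<beta> # u)" using g w by simp
          then show ?thesis by blast
        next
          case False
          then have "wv (g # w) = v (letter c \<beta>) \<otimes> v (letter (\<not> c) \<beta>') \<otimes> tv c' u'"
            using g w Cons by (simp add: V.m_assoc)
          then have "wv (g # w) = \<zero>" by (simp only: mixed V.l_null tv_closed)
          then show ?thesis by blast
        qed
      qed
    next
      assume "wv w = \<zero>"
      then show ?thesis by (simp add: g)
    qed
  qed
  then show ?thesis using that by blast
qed

text \<open>The last letter of \<open>u\<close> meets the first letter of \<open>w\<close>. Both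
  must exist: the empty word has value 1 in either type.\<close>

lemma tv_mixed:
  assumes "u \<noteq> []" "w \<noteq> []"
  shows "tv c u \<otimes> tv (\<not> c) w = \<zero>"
proof -
  obtain \<beta> w' where w: "w = \<beta> # w'" using assms by (cases w) auto
  obtain u' \<beta>' where u: "u = u' @ [\<beta>']" using assms by (cases u rule: rev_cases) auto
  have "tv c u \<otimes> tv (\<not> c) w = tv c u' \<otimes> (v (letter c \<beta>') \<otimes> v (letter (\<not> c) \<beta>) \<otimes> tv (\<not> c) w')"
    unfolding u tv_append by (simp add: w V.m_assoc)
  then show ?thesis by (simp add: mixed)
qed

text \<open>The letters are grouped in pairs, and the squares of the two letters of a type
  agree.\<close>

lemma tv_replicate: "tv c (replicate (2 * m) \<beta>) = tv c (replicate (2 * m) False)"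
proof (induction m)
  case (Suc m)
  have *: "tv c (replicate (2 * Suc m) \<beta>) = v (letter c \<beta>) \<otimes> v (letter c \<beta>) \<otimes> tv c (replicate (2 * m) \<beta>)" for \<beta>
    by (simp add: V.m_assoc)
  have "v (letter c \<beta>) \<otimes> v (letter c \<beta>) = v (letter c False) \<otimes> v (letter c False)"
    using square by (cases \<beta>) auto
  then show ?case unfolding *[of \<beta>] *[of False] by (simp only: Suc)
qed simp

lemma linear_ext_word: "w \<in> lists X \<Longrightarrow> linear_ext V wv (word w) = wv w"
  by (simp add: wv_closed)

lemma wv_Pi: "wv \<in> lists X \<rightarrow> carrier V"
  by (rule Pi_I) (rule wv_closed)

text \<open>Converts the multiplicative conditions of the locale into the vanishing on encoded
  relations that \<open>presented_hom_coset\<close> asks for.\<close>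

lemma linear_ext_Rel:
  assumes "r \<in> Rel"
  shows "linear_ext V wv r = \<zero>"
proof -
  note minus = V.linear_ext_minus[OF _ _ wv_Pi] and add = V.linear_ext_add[OF _ _ wv_Pi]
  have k: "Poly_Mapping.keys (word w :: _ \<Rightarrow>\<^sub>0 'k) \<subseteq> lists X" if "w \<in> lists X" for w
    using that by simp
  note kt = k[OF typed_lists]
  note rels = square mixed unit
  from assms show ?thesis
  proof (cases rule: suzuki_relations_cases)
    case (square c)
    show ?thesis
      unfolding square minus[OF kt kt] linear_ext_word[OF typed_lists]
      using rels(1)[of c] by (simp add: V.minus_eq V.r_neg)
  next
    case (mixed c \<beta> \<beta>')
    have "[letter c \<beta>, letter (\<not> c) \<beta>'] \<in> lists X" by simp
    from linear_ext_word[OF this] show ?thesis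
      unfolding mixed by (simp add: rels(2))
  next
    case unit
    have "Poly_Mapping.keys (word (typed False (replicate (2 * N) False))
        + word (typed True (replicate (2 * N) False)) :: _ \<Rightarrow>\<^sub>0 'k) \<subseteq> lists X"
      by (rule subset_trans[OF keys_add Un_least[OF kt kt]])
    moreover have nil: "[] \<in> lists X" by simp
    ultimately show ?thesis
      unfolding unit
      by (simp only: minus[OF _ k] add[OF kt kt] linear_ext_word typed_lists rels(3))
        (simp add: V.minus_eq V.r_neg)
  next
    case (alternating c)
    show ?thesis
      unfolding alternating minus[OF kt kt] linear_ext_word[OF typed_lists]
      using alt[of c] by (cases c) (simp_all add: V.minus_eq V.r_neg)
  qed
qed

abbreviation hom where "hom \<equiv> presented_hom V v"

lemma hom_coset:
  assumes "f \<in> carrier Free"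
  shows "hom (I +>\<^bsub>Free\<^esub> f) = linear_ext V wv f"
  unfolding suzuki_ideal_def
  using assms linear_ext_Rel
  by (intro presented_hom_coset V.assoc_algebra_axioms v_closed Rel_carrier)
    (simp_all add: free_algebra_def)

lemma Alg_cases:
  assumes "a \<in> carrier Alg"
  obtains f where "f \<in> carrier Free" "a = I +>\<^bsub>Free\<^esub> f"
  using assms by (auto simp: suzuki_algebra_def P.quotient_carrier)

lemma hom_closed [simp, intro]:
  assumes "a \<in> carrier Alg"
  shows "hom a \<in> carrier V"
proof -
  obtain f where f: "f \<in> carrier Free" "a = I +>\<^bsub>Free\<^esub> f" using assms by (rule Alg_cases)
  then show ?thesis
    using V.linear_ext_closed[OF _ wv_Pi, of f] by (simp add: hom_coset) (simp add: free_algebra_def)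
qed

lemma hom_add:
  assumes "a \<in> carrier Alg" "b \<in> carrier Alg"
  shows "hom (a \<oplus>\<^bsub>Alg\<^esub> b) = hom a \<oplus> hom b"
proof -
  obtain f where f: "f \<in> carrier Free" "a = I +>\<^bsub>Free\<^esub> f" using assms(1) by (rule Alg_cases)
  obtain g where g: "g \<in> carrier Free" "b = I +>\<^bsub>Free\<^esub> g" using assms(2) by (rule Alg_cases)
  have "a \<oplus>\<^bsub>Alg\<^esub> b = I +>\<^bsub>Free\<^esub> (f \<oplus>\<^bsub>Free\<^esub> g)"
    using f g by (simp add: suzuki_algebra_def P.quotient_simps)
  then show ?thesis
    using f g V.linear_ext_add[OF _ _ wv_Pi, of f g]
    by (simp add: hom_coset) (simp add: free_algebra_def)
qed

lemma hom_smult: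
  assumes "a \<in> carrier Alg"
  shows "hom (c \<odot>\<^bsub>Alg\<^esub> a) = c \<odot> hom a"
proof -
  obtain f where f: "f \<in> carrier Free" "a = I +>\<^bsub>Free\<^esub> f" using assms(1) by (rule Alg_cases)
  have "c \<odot>\<^bsub>Alg\<^esub> a = I +>\<^bsub>Free\<^esub> (c \<odot>\<^bsub>Free\<^esub> f)"
    using f by (simp add: suzuki_algebra_def P.quotient_smult)
  then show ?thesis
    using f V.linear_ext_scale[OF _ wv_Pi, of f]
    by (simp add: hom_coset) (simp add: free_algebra_def)
qed

lemma hom_mult:
  assumes "a \<in> carrier Alg" "b \<in> carrier Alg"
  shows "hom (a \<otimes>\<^bsub>Alg\<^esub> b) = hom a \<otimes> hom b"
proof -
  obtain f where f: "f \<in> carrier Free" "a = I +>\<^bsub>Free\<^esub> f" using assms(1) by (rule Alg_cases)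
  obtain g where g: "g \<in> carrier Free" "b = I +>\<^bsub>Free\<^esub> g" using assms(2) by (rule Alg_cases)
  have "a \<otimes>\<^bsub>Alg\<^esub> b = I +>\<^bsub>Free\<^esub> (f \<otimes>\<^bsub>Free\<^esub> g)"
    using f g by (simp add: suzuki_algebra_def P.quotient_simps)
  moreover have "linear_ext V wv (f \<otimes>\<^bsub>Free\<^esub> g) = linear_ext V wv f \<otimes> linear_ext V wv g"
    unfolding free_algebra_def
  proof (rule V.linear_ext_mult[OF free_monoid])
    show "wv \<in> carrier (free_monoid X) \<rightarrow> carrier V"
      unfolding free_monoid_simps by (rule wv_Pi)
    show "Poly_Mapping.keys f \<subseteq> carrier (free_monoid X)"
      "Poly_Mapping.keys g \<subseteq> carrier (free_monoid X)"
      using f(1) g(1) by (simp_all add: free_algebra_def)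
    fix p q assume "p \<in> carrier (free_monoid X)" "q \<in> carrier (free_monoid X)"
    then show "wv (p \<otimes>\<^bsub>free_monoid X\<^esub> q) = wv p \<otimes> wv q"
      unfolding free_monoid_simps by (rule V.word_value_append[OF _ _ v_closed])
  qed
  ultimately show ?thesis using f g by (simp add: hom_coset)
qed

lemma hom_word:
  assumes "w \<in> lists X"
  shows "hom (I +>\<^bsub>Free\<^esub> word w) = wv w"
  using assms by (simp only: hom_coset word_carrier linear_ext_word)

lemma hom_one: "hom \<one>\<^bsub>Alg\<^esub> = \<one>"
  using hom_word[of "[]"] by (simp add: Alg_one)

end

section \<open>The generators as a representation, and a spanning set of words\<close>

context suzuki
begin

text \<open>The tautological representation: facts about values of words in a representation become
  facts about words in \<open>Alg\<close> itself.\<close>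

lemma generators_rep: "suzuki_rep N n Alg x"
proof (intro suzuki_rep.intro suzuki_rep_axioms.intro)
  have sing: "x g = word_value Alg x [g]" if "g \<in> X" for g
    using that by (subst word_value_Alg) (simp_all add: suzuki_x_def)
  have xc: "x g \<in> carrier Alg" if "g \<in> X" for g
    using that word_carrier[of "[g]"] by (simp add: suzuki_x_def suzuki_algebra_def P.quotient_coset_closed)
  show "suzuki N n" by unfold_locales
  show "assoc_algebra Alg" by unfold_locales
  show "x \<in> X \<rightarrow> carrier Alg" using xc by auto
  fix c \<beta> \<beta>'
  have [simp]: "x (letter c \<beta>) \<in> carrier Alg" for c \<beta> using xc by simp
  have "word [letter c \<beta>, letter (\<not> c) \<beta>'] \<in> I"
    by (rule subsetD[OF Rel_I suzuki_relations_mem(2)])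
  then have *: "I +>\<^bsub>Free\<^esub> word [letter c \<beta>, letter (\<not> c) \<beta>'] = I +>\<^bsub>Free\<^esub> \<zero>\<^bsub>Free\<^esub>"
    using P.a_coset_add_zero P.a_rcos_const by (simp add: P.a_subset)
  have "x (letter c \<beta>) \<otimes>\<^bsub>Alg\<^esub> x (letter (\<not> c) \<beta>') =
      word_value Alg x [letter c \<beta>, letter (\<not> c) \<beta>']" by simp
  also have "\<dots> = I +>\<^bsub>Free\<^esub> word [letter c \<beta>, letter (\<not> c) \<beta>']"
    by (rule word_value_Alg) simp
  also have "\<dots> = \<zero>\<^bsub>Alg\<^esub>"
    unfolding * by (simp only: suzuki_algebra_def P.quotient_simps)
  finally show "x (letter c \<beta>) \<otimes>\<^bsub>Alg\<^esub> x (letter (\<not> c) \<beta>') = \<zero>\<^bsub>Alg\<^esub>" .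
  have typed_eq: "word_value Alg x (typed c u) = word_value Alg x (typed c w)"
    if "word (typed c u) - word (typed c w) \<in> Rel" for c u w
    using coset_word_eq[OF that] by (simp only: word_value_Alg typed_lists)
  have "word_value Alg x (typed c [False, False]) = word_value Alg x (typed c [True, True])"
    by (rule typed_eq[OF suzuki_relations_mem(1)])
  then show "x (letter c True) \<otimes>\<^bsub>Alg\<^esub> x (letter c True) = x (letter c False) \<otimes>\<^bsub>Alg\<^esub> x (letter c False)"
    by simp
  show "word_value Alg x (typed c (alternating n False True)) =
      word_value Alg x (typed c (alternating n True False))"
    using typed_eq[OF suzuki_relations_mem(4)[of c]] by (cases c) simp_all
  let ?u = "word (typed False (replicate (2 * N) False)) :: _ \<Rightarrow>\<^sub>0 'k"
  let ?w = "word (typed True (replicate (2 * N) False)) :: _ \<Rightarrow>\<^sub>0 'k"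
  have c: "?u \<in> carrier Free" "?w \<in> carrier Free" "word [] \<in> carrier Free"
    by (intro word_carrier, simp)+
  have "?u + ?w = ?u \<oplus>\<^bsub>Free\<^esub> ?w" by (simp add: free_algebra_def)
  then have uw: "?u + ?w \<in> carrier Free" using P.add.m_closed[OF c(1,2)] by (simp only:)
  have "(?u + ?w) \<ominus>\<^bsub>Free\<^esub> word [] = ?u + ?w - word []"
    using uw c(3) unfolding free_algebra_def by (intro monoid_algebra_minus free_monoid)
  then have "I +>\<^bsub>Free\<^esub> (?u + ?w) = I +>\<^bsub>Free\<^esub> word []"
    using suzuki_relations_mem(3)[of N n] Rel_I uw c by (subst P.coset_eq_iff) auto
  then show "word_value Alg x (typed False (replicate (2 * N) False)) \<oplus>\<^bsub>Alg\<^esub>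
      word_value Alg x (typed True (replicate (2 * N) False)) = \<one>\<^bsub>Alg\<^esub>"
    using c \<open>?u + ?w = ?u \<oplus>\<^bsub>Free\<^esub> ?w\<close>
    by (simp only: word_value_Alg typed_lists Alg_one) (simp add: suzuki_algebra_def P.quotient_simps)
qed

sublocale self: suzuki_rep N n kt Alg x
  by (rule generators_rep)

abbreviation W where "W c u \<equiv> word_value Alg x (typed c u)"

text \<open>Nonempty words of a single type span \<open>Alg\<close>. The empty word, which would
  belong to both types, is avoided throughout, as group and coproduct formulas fail for it.\<close>

lemma Alg_induct [consumes 1, case_names zero add smult word]:
  assumes "a \<in> carrier Alg"
    and zero: "P \<zero>\<^bsub>Alg\<^esub>"
    and add: "\<And>a b. a \<in> carrier Alg \<Longrightarrow> b \<in> carrier Alg \<Longrightarrow> P a \<Longrightarrow> P b \<Longrightarrow> P (a \<oplus>\<^bsub>Alg\<^esub> b)"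
    and smult: "\<And>c a. a \<in> carrier Alg \<Longrightarrow> P a \<Longrightarrow> P (c \<odot>\<^bsub>Alg\<^esub> a)"
    and word: "\<And>c u. u \<noteq> [] \<Longrightarrow> P (W c u)"
  shows "P a"
proof -
  have "P (word_value Alg x w)" if "w \<in> lists X" for w
    using that
  proof (cases rule: self.wv_cases)
    case (1 c u)
    show ?thesis
    proof (cases "u = []")
      case True
      \<comment> \<open>The unit relation replaces the empty word by two words of length
        \<open>2 * N\<close>, which are nonempty as \<open>N\<close> is positive.\<close>
      have "P (W False (replicate (2 * N) False) \<oplus>\<^bsub>Alg\<^esub> W True (replicate (2 * N) False))"
        using N by (intro add word self.tv_closed) auto
      then show ?thesis using 1 True by (simp add: self.unit)
    next
      case False
      then show ?thesis using 1 word by simp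
    qed
  next
    case 2
    then show ?thesis using zero by simp
  qed
  then have wordP: "P (I +>\<^bsub>Free\<^esub> word w)" if "w \<in> lists X" for w
    using that by (simp only: word_value_Alg)
  have "P (I +>\<^bsub>Free\<^esub> f)" if "Poly_Mapping.keys f \<subseteq> lists X" for f
    using that
  proof (induction f rule: poly_mapping_keys_induct)
    case zero
    have "I +>\<^bsub>Free\<^esub> 0 = \<zero>\<^bsub>Alg\<^esub>"
      by (simp add: suzuki_algebra_def P.quotient_simps) (simp add: free_algebra_def)
    then show ?case using assms(2) by simp
  next
    case (single_add w c f)
    note w = word_carrier[OF single_add(1)]
    have f: "f \<in> carrier Free" using single_add by (simp add: free_algebra_def)
    have "Poly_Mapping.single w c + f = (c \<odot>\<^bsub>Free\<^esub> word w) \<oplus>\<^bsub>Free\<^esub> f"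
      by (simp add: free_algebra_def)
    then have "I +>\<^bsub>Free\<^esub> (Poly_Mapping.single w c + f) =
        c \<odot>\<^bsub>Alg\<^esub> (I +>\<^bsub>Free\<^esub> word w) \<oplus>\<^bsub>Alg\<^esub> (I +>\<^bsub>Free\<^esub> f)"
      using w f by (simp add: suzuki_algebra_def P.quotient_simps P.quotient_smult)
    moreover have "I +>\<^bsub>Free\<^esub> word w \<in> carrier Alg" "I +>\<^bsub>Free\<^esub> f \<in> carrier Alg"
      using w f by (simp_all add: suzuki_algebra_def P.quotient_coset_closed)
    ultimately show ?case
      using single_add wordP by (simp only:) (intro add smult Alg.smult_closed)
  qed
  moreover obtain f where "f \<in> carrier Free" "a = I +>\<^bsub>Free\<^esub> f"
    using assms(1) by (rule self.Alg_cases)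
  ultimately show ?thesis by (simp add: free_algebra_def)
qed

section \<open>The group formed by the words of one type\<close>

definition type_group :: "bool \<Rightarrow> (gen list \<Rightarrow>\<^sub>0 'k) set monoid" where
  "type_group c = \<lparr>carrier = {W c u | u. u \<noteq> []}, monoid.mult = monoid.mult Alg,
    one = W c (replicate (2 * N) False)\<rparr>"

lemma type_group_closed: "u \<noteq> [] \<Longrightarrow> W c u \<in> carrier (type_group c)"
  by (auto simp: type_group_def)

text \<open>Multiply by 1 written as the sum of the two unit idempotents; the one of the other type
  annihilates \<open>W c u\<close>. Thus the idempotent of type \<open>c\<close>, rather than the
  unit of \<open>Alg\<close>, is neutral in \<open>type_group c\<close>.\<close>

lemma unit_mult: "W c (replicate (2 * N) \<beta> @ u) = W c u" if "u \<noteq> []"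
proof -
  let ?e = "\<lambda>c. W c (replicate (2 * N) False)"
  have "?e c \<oplus>\<^bsub>Alg\<^esub> ?e (\<not> c) = \<one>\<^bsub>Alg\<^esub>"
  proof (cases c)
    case True
    then have c: "c = True" by blast
    show ?thesis
      unfolding c not_True_eq_False Alg.a_comm[OF self.tv_closed[of True] self.tv_closed[of False]]
      by (rule self.unit)
  next
    case False
    then have c: "c = False" by blast
    show ?thesis unfolding c not_False_eq_True by (rule self.unit)
  qed
  then have "W c u = (?e c \<oplus>\<^bsub>Alg\<^esub> ?e (\<not> c)) \<otimes>\<^bsub>Alg\<^esub> W c u"
    by (simp only: Alg.l_one self.tv_closed)
  also have "\<dots> = ?e c \<otimes>\<^bsub>Alg\<^esub> W c u \<oplus>\<^bsub>Alg\<^esub> ?e (\<not> c) \<otimes>\<^bsub>Alg\<^esub> W c u"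
    by (intro Alg.l_distr self.tv_closed)
  also have "?e (\<not> c) \<otimes>\<^bsub>Alg\<^esub> W c u = \<zero>\<^bsub>Alg\<^esub>"
    using self.tv_mixed[of "replicate (2 * N) False" u "\<not> c"] N that
    unfolding not_not by simp
  also have "?e c = W c (replicate (2 * N) \<beta>)" by (rule self.tv_replicate[symmetric])
  also have "W c (replicate (2 * N) \<beta>) \<otimes>\<^bsub>Alg\<^esub> W c u \<oplus>\<^bsub>Alg\<^esub> \<zero>\<^bsub>Alg\<^esub> = W c (replicate (2 * N) \<beta> @ u)"
    unfolding self.tv_append by (intro Alg.r_zero Alg.m_closed self.tv_closed)
  finally show ?thesis by (rule sym)
qed

text \<open>A letter is inverted by its power with exponent \<open>2 * N - 1\<close>, which is
  appended to a left inverse of the tail. A single letter is treated apart because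
  \<open>unit_mult\<close> concerns nonempty words.\<close>

lemma left_inverse: "u \<noteq> [] \<Longrightarrow> \<exists>w. w \<noteq> [] \<and> W c (w @ u) = W c (replicate (2 * N) False)"
proof (induction u)
  case (Cons \<beta> u)
  have r: "replicate (2 * N - 1) \<beta> @ [\<beta>] = replicate (2 * N) \<beta>"
    using N by (cases N) (simp_all add: replicate_append_same)
  show ?case
  proof (cases "u = []")
    case True
    have "W c (replicate (2 * N - 1) \<beta> @ [\<beta>]) = W c (replicate (2 * N) False)"
      unfolding r by (rule self.tv_replicate)
    then show ?thesis using True N by (intro exI[of _ "replicate (2 * N - 1) \<beta>"]) simp
  next
    case False
    then obtain w where w: "w \<noteq> []" "W c (w @ u) = W c (replicate (2 * N) False)"
      using Cons.IH by blast
    have "W c ((w @ replicate (2 * N - 1) \<beta>) @ \<beta> # u) = W c (w @ (replicate (2 * N) \<beta> @ u))"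
      unfolding r[symmetric] by simp
    also have "\<dots> = W c w \<otimes>\<^bsub>Alg\<^esub> W c (replicate (2 * N) \<beta> @ u)" by (rule self.tv_append)
    also have "\<dots> = W c (w @ u)" unfolding unit_mult[OF False] by (rule self.tv_append[symmetric])
    finally show ?thesis using w by (intro exI[of _ "w @ replicate (2 * N - 1) \<beta>"]) simp
  qed
qed simp

lemma type_group: "group (type_group c)"
proof (rule groupI)
  fix a b d assume "a \<in> carrier (type_group c)" "b \<in> carrier (type_group c)" "d \<in> carrier (type_group c)"
  then obtain u w y where u: "a = W c u" "u \<noteq> []" "b = W c w" "w \<noteq> []" "d = W c y"
    unfolding type_group_def by auto
  show "a \<otimes>\<^bsub>type_group c\<^esub> b \<in> carrier (type_group c)"
    using u by (auto simp: type_group_def simp flip: self.tv_append intro!: exI[of _ "u @ w"])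
  show "a \<otimes>\<^bsub>type_group c\<^esub> b \<otimes>\<^bsub>type_group c\<^esub> d = a \<otimes>\<^bsub>type_group c\<^esub> (b \<otimes>\<^bsub>type_group c\<^esub> d)"
    using u by (simp add: type_group_def self.tv_closed Alg.m_assoc)
  show "\<one>\<^bsub>type_group c\<^esub> \<otimes>\<^bsub>type_group c\<^esub> a = a"
    using u by (simp add: type_group_def unit_mult del: typed_simps flip: self.tv_append)
  obtain w' where "w' \<noteq> []" "W c (w' @ u) = W c (replicate (2 * N) False)"
    using left_inverse[OF u(2)] by blast
  then show "\<exists>y\<in>carrier (type_group c). y \<otimes>\<^bsub>type_group c\<^esub> a = \<one>\<^bsub>type_group c\<^esub>"
    using u by (intro bexI[of _ "W c w'"]) (auto simp: type_group_def simp flip: self.tv_append)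
next
  show "\<one>\<^bsub>type_group c\<^esub> \<in> carrier (type_group c)"
    using N by (auto simp: type_group_def intro!: exI[of _ "replicate (2 * N) False"])
qed

text \<open>Evaluation in the group and in \<open>Alg\<close> differ only at the empty word, where
  the group has the idempotent as its unit.\<close>

lemma type_group_word:
  "word_value (type_group c) (\<lambda>\<beta>. if \<beta> then W c [True] else W c [False]) u =
    (if u = [] then \<one>\<^bsub>type_group c\<^esub> else W c u)"
proof (induction u)
  case (Cons \<beta> u)
  interpret G: group "type_group c" by (rule type_group)
  have eq: "(if \<beta> then W c [True] else W c [False]) = W c [\<beta>]" by simp
  have b: "W c [\<beta>] \<in> carrier (type_group c)"
    by (rule type_group_closed) simp
  show ?case
  proof (cases "u = []")
    case True
    show ?thesis using G.r_one[OF b] True by (simp only: eq word_value_simps) simp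
  next
    case False
    have "W c [\<beta>] \<otimes>\<^bsub>type_group c\<^esub> W c u = W c ([\<beta>] @ u)"
      unfolding self.tv_append by (simp add: type_group_def)
    then show ?thesis using False Cons by (simp only: eq word_value_simps) simp
  qed
qed simp

text \<open>The invariant \<open>(l, r)\<close> of the overview. By \<open>W_eq\<close> and
  \<open>indicator_form_W\<close>, two nonempty words of the same type are equal in
  \<open>Alg\<close> exactly when their classes agree.\<close>

definition cls :: "bool list \<Rightarrow> int \<times> int" where
  "cls u = (int (length u) mod int (2 * N), rot u mod int n)"

text \<open>The words may be evaluated in \<open>type_group c\<close>, where the normal form behind
  \<open>word_value_eq\<close> gives the equality.\<close>

lemma W_eq:
  assumes "u \<noteq> []" "w \<noteq> []" "cls u = cls w"
  shows "W c u = W c w"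
proof -
  interpret G: group "type_group c" by (rule type_group)
  let ?v = "\<lambda>\<beta>. if \<beta> then W c [True] else W c [False]"
  have "word_value (type_group c) ?v u = word_value (type_group c) ?v w"
  proof (rule G.word_value_eq)
    show "W c [False] \<in> carrier (type_group c)" "W c [True] \<in> carrier (type_group c)"
      by (rule type_group_closed, simp)+
    show "W c [True] \<otimes>\<^bsub>type_group c\<^esub> W c [True] = W c [False] \<otimes>\<^bsub>type_group c\<^esub> W c [False]"
      using self.square[of c] by (simp add: type_group_def self.v_letter)
    show "word_value (type_group c) ?v (replicate (2 * N) False) = \<one>\<^bsub>type_group c\<^esub>"
      unfolding type_group_word using N by (simp add: type_group_def)
    show "word_value (type_group c) ?v (alternating n False True) =
        word_value (type_group c) ?v (alternating n True False)"
      unfolding type_group_word using self.alt[of c] by (simp add: alternating_not_Nil)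
  qed (use assms even_n in \<open>simp_all add: cls_def\<close>)
  then show ?thesis using assms by (simp only: type_group_word) simp
qed

section \<open>The coproduct on words\<close>

sublocale pair: algebra_pair Alg Alg
  by unfold_locales

abbreviation "Tensor \<equiv> tensor Alg Alg"
abbreviation "pure \<equiv> pure_tensor Alg Alg"

sublocale T: assoc_algebra Tensor
  by (rule pair.tensor_algebra)

definition comult_gen :: "gen \<Rightarrow> ('k, (gen list \<Rightarrow>\<^sub>0 'k) set, (gen list \<Rightarrow>\<^sub>0 'k) set) tensor" where
  "comult_gen = (\<lambda>(i, j). pure (x (i, 1)) (x (1, j)) \<oplus>\<^bsub>Tensor\<^esub> pure (x (i, 2)) (x (2, j)))"

text \<open>The two values of \<open>c\<close> give the two coproduct formulas of the overview, with
  \<open>map Not\<close> as \<open>\<sigma>\<close>. At the empty word the expression would be twice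
  the unit, so it describes the coproduct of nonempty words only.\<close>

abbreviation comult_word where
  "comult_word c u \<equiv> pure (W False u) (W c u) \<oplus>\<^bsub>Tensor\<^esub> pure (W True u) (W (\<not> c) (map Not u))"

lemma pure_closed [simp, intro]: "pure (W c u) (W d w) \<in> carrier Tensor"
  by (intro pair.pure_tensor_closed self.tv_closed)

lemma comult_gen_letter: "comult_gen (letter c \<beta>) = comult_word c [\<beta>]"
proof -
  have xc: "x (letter c \<beta>) \<in> carrier Alg" for c \<beta> by (rule self.v_letter)
  have W1: "W c [\<beta>] = x (letter c \<beta>)" for c \<beta> using xc by simp
  have "pure (x (letter c \<beta>)) (x (letter d \<gamma>)) \<in> carrier Tensor" for c \<beta> d \<gamma>
    using xc by (rule pair.pure_tensor_closed[OF _ xc])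
  \<comment> \<open>When the first index is 2, the matrix formula lists the left factor of type
    \<open>True\<close> first, so the two summands have to be exchanged.\<close>
  note comm = T.a_comm[OF this[of True True "\<not> c" False] this[of False True c True]]
  show ?thesis
    unfolding W1 list.map comult_gen_def
    by (cases \<beta>; cases c) (use comm in \<open>simp_all add: letter_def\<close>)
qed

lemma pure_mult:
  "pure (W c u) (W d w) \<otimes>\<^bsub>Tensor\<^esub> pure (W c' u') (W d' w') =
    pure (W c u \<otimes>\<^bsub>Alg\<^esub> W c' u') (W d w \<otimes>\<^bsub>Alg\<^esub> W d' w')"
  by (intro pair.pure_tensor_mult self.tv_closed)

lemma pure_mult_same: "pure (W c u) (W d w) \<otimes>\<^bsub>Tensor\<^esub> pure (W c u') (W d w') =
    pure (W c (u @ u')) (W d (w @ w'))"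
  unfolding pure_mult self.tv_append ..

lemma pure_mult_left_mixed:
  assumes "u \<noteq> []" "u' \<noteq> []"
  shows "pure (W c u) (W d w) \<otimes>\<^bsub>Tensor\<^esub> pure (W (\<not> c) u') (W d' w') = \<zero>\<^bsub>Tensor\<^esub>"
  unfolding pure_mult self.tv_mixed[OF assms]
  by (intro pair.pure_tensor_zero(1)[OF Alg.zero_closed] Alg.m_closed self.tv_closed)

lemma pure_mult_right_mixed:
  assumes "w \<noteq> []" "w' \<noteq> []"
  shows "pure (W c u) (W d w) \<otimes>\<^bsub>Tensor\<^esub> pure (W c' u') (W (\<not> d) w') = \<zero>\<^bsub>Tensor\<^esub>"
  unfolding pure_mult self.tv_mixed[OF assms]
  by (intro pair.pure_tensor_zero(2)[OF _ Alg.zero_closed] Alg.m_closed self.tv_closed)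

text \<open>Of the four products, two vanish because their left factors have different types. The
  other two concatenate if \<open>c = d\<close> and vanish through their right factors
  otherwise.\<close>

lemma comult_word_mult:
  assumes "u \<noteq> []" "w \<noteq> []"
  shows "comult_word c u \<otimes>\<^bsub>Tensor\<^esub> comult_word d w =
    (if c = d then comult_word c (u @ w) else \<zero>\<^bsub>Tensor\<^esub>)"
proof -
  have nmu: "map Not u \<noteq> []" "map Not w \<noteq> []" using assms by auto
  have l: "pure (W False u) a \<otimes>\<^bsub>Tensor\<^esub> pure (W True w) b = \<zero>\<^bsub>Tensor\<^esub>"
     "pure (W True u) a \<otimes>\<^bsub>Tensor\<^esub> pure (W False w) b = \<zero>\<^bsub>Tensor\<^esub>"
    if "a = W c' u'" "b = W d' w'" for a b c' d' u' w'
    using pure_mult_left_mixed[OF assms, of False] pure_mult_left_mixed[OF assms, of True] that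
    by simp_all
  have "comult_word c u \<otimes>\<^bsub>Tensor\<^esub> comult_word d w =
     (pure (W False u) (W c u) \<otimes>\<^bsub>Tensor\<^esub> pure (W False w) (W d w)
      \<oplus>\<^bsub>Tensor\<^esub> pure (W False u) (W c u) \<otimes>\<^bsub>Tensor\<^esub> pure (W True w) (W (\<not> d) (map Not w)))
     \<oplus>\<^bsub>Tensor\<^esub> (pure (W True u) (W (\<not> c) (map Not u)) \<otimes>\<^bsub>Tensor\<^esub> pure (W False w) (W d w)
      \<oplus>\<^bsub>Tensor\<^esub> pure (W True u) (W (\<not> c) (map Not u)) \<otimes>\<^bsub>Tensor\<^esub> pure (W True w) (W (\<not> d) (map Not w)))"
    unfolding T.l_distr[OF pure_closed pure_closed T.a_closed[OF pure_closed pure_closed]]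
      T.r_distr[OF pure_closed pure_closed pure_closed] ..
  also have "\<dots> = pure (W False u) (W c u) \<otimes>\<^bsub>Tensor\<^esub> pure (W False w) (W d w)
     \<oplus>\<^bsub>Tensor\<^esub> pure (W True u) (W (\<not> c) (map Not u)) \<otimes>\<^bsub>Tensor\<^esub> pure (W True w) (W (\<not> d) (map Not w))"
    by (simp only: l[OF refl refl] T.l_zero T.r_zero T.m_closed pure_closed)
  also have "\<dots> = (if c = d then comult_word c (u @ w) else \<zero>\<^bsub>Tensor\<^esub>)"
  proof (cases "c = d")
    case True
    then show ?thesis by (simp only: pure_mult_same map_append if_True simp_thms)
  next
    case False
    then have d: "d = (\<not> c)" by auto
    have "pure (W False u) (W c u) \<otimes>\<^bsub>Tensor\<^esub> pure (W False w) (W d w) = \<zero>\<^bsub>Tensor\<^esub>"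
      "pure (W True u) (W (\<not> c) (map Not u)) \<otimes>\<^bsub>Tensor\<^esub> pure (W True w) (W (\<not> d) (map Not w)) = \<zero>\<^bsub>Tensor\<^esub>"
      unfolding d by (rule pure_mult_right_mixed[OF assms], rule pure_mult_right_mixed[OF nmu])
    then show ?thesis using False by (simp only: if_False T.l_zero T.zero_closed)
  qed
  finally show ?thesis .
qed

lemma comult_gen_closed: "comult_gen (letter c \<beta>) \<in> carrier Tensor"
  unfolding comult_gen_letter by (intro T.a_closed pure_closed)

lemma word_value_comult:
  assumes "u \<noteq> []"
  shows "word_value Tensor comult_gen (typed c u) = comult_word c u"
  using assms
proof (induction u rule: list_nonempty_induct)
  case (single \<beta>)
  have "word_value Tensor comult_gen (typed c [\<beta>]) = comult_gen (letter c \<beta>)"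
    unfolding typed_simps word_value_simps by (rule T.r_one[OF comult_gen_closed])
  then show ?case unfolding comult_gen_letter .
next
  case (cons \<beta> u)
  show ?case
    unfolding typed_simps(2) word_value_simps cons.IH comult_gen_letter
    using comult_word_mult[of "[\<beta>]" u c c] cons.hyps by (simp only: append_Cons append_Nil) simp
qed

text \<open>This is the well-definedness of the coproduct. Through \<open>comult_word\<close>, a
  relation within one type reduces to relations in the tensor factors; the unit relation comes from
  expanding the tensor square of the sum of the two idempotents.\<close>

lemma comult_rep: "suzuki_rep N n Tensor comult_gen"
proof (intro suzuki_rep.intro suzuki_rep_axioms.intro)
  show "suzuki N n" "assoc_algebra Tensor" by unfold_locales
  show "comult_gen \<in> X \<rightarrow> carrier Tensor"
    using comult_gen_closed by (metis Pi_I letter_cases)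
  fix c \<beta> \<beta>'
  show "comult_gen (letter c \<beta>) \<otimes>\<^bsub>Tensor\<^esub> comult_gen (letter (\<not> c) \<beta>') = \<zero>\<^bsub>Tensor\<^esub>"
    unfolding comult_gen_letter by (subst comult_word_mult) simp_all
  have WTF: "W c [True, True] = W c [False, False]" for c
    using self.square[of c] by (simp add: self.v_letter)
  have "comult_word c [True, True] = comult_word c [False, False]"
    unfolding list.map not_True_eq_False not_False_eq_True WTF ..
  then show "comult_gen (letter c True) \<otimes>\<^bsub>Tensor\<^esub> comult_gen (letter c True) =
      comult_gen (letter c False) \<otimes>\<^bsub>Tensor\<^esub> comult_gen (letter c False)"
    unfolding comult_gen_letter by (subst (1 2) comult_word_mult) simp_all
  show "word_value Tensor comult_gen (typed c (alternating n False True)) =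
      word_value Tensor comult_gen (typed c (alternating n True False))"
    unfolding word_value_comult[OF alternating_not_Nil] map_alternating not_True_eq_False not_False_eq_True
      self.alt ..
  let ?r = "replicate (2 * N) False"
  let ?e = "\<lambda>c. W c ?r"
  have r: "?r \<noteq> []" using N by simp
  have map: "map Not ?r = replicate (2 * N) True" by simp
  have e: "W c (replicate (2 * N) True) = ?e c" for c by (rule self.tv_replicate)
  have "word_value Tensor comult_gen (typed False ?r) \<oplus>\<^bsub>Tensor\<^esub> word_value Tensor comult_gen (typed True ?r)
    = (pure (?e False) (?e False) \<oplus>\<^bsub>Tensor\<^esub> pure (?e True) (?e True))
      \<oplus>\<^bsub>Tensor\<^esub> (pure (?e False) (?e True) \<oplus>\<^bsub>Tensor\<^esub> pure (?e True) (?e False))"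
    unfolding word_value_comult[OF r] map e not_True_eq_False not_False_eq_True ..
  \<comment> \<open>Regrouped by the left factor, the four terms are the expansion of a single pure
    tensor.\<close>
  also have "\<dots> = (pure (?e False) (?e False) \<oplus>\<^bsub>Tensor\<^esub> pure (?e False) (?e True))
      \<oplus>\<^bsub>Tensor\<^esub> (pure (?e True) (?e False) \<oplus>\<^bsub>Tensor\<^esub> pure (?e True) (?e True))"
    using pure_closed[of _ ?r _ ?r] by (simp add: T.a_ac)
  also have "\<dots> = pure (?e False \<oplus>\<^bsub>Alg\<^esub> ?e True) (?e False \<oplus>\<^bsub>Alg\<^esub> ?e True)"
    unfolding pair.pure_tensor_add_left[OF self.tv_closed self.tv_closed Alg.add.m_closed[OF self.tv_closed self.tv_closed]]
      pair.pure_tensor_add_right[OF self.tv_closed self.tv_closed self.tv_closed] ..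
  also have "\<dots> = \<one>\<^bsub>Tensor\<^esub>"
    unfolding self.unit pair.pure_tensor_one ..
  finally show "word_value Tensor comult_gen (typed False ?r) \<oplus>\<^bsub>Tensor\<^esub>
    word_value Tensor comult_gen (typed True ?r) = \<one>\<^bsub>Tensor\<^esub>" .
qed

sublocale \<Delta>: suzuki_rep N n kt Tensor comult_gen
  by (rule comult_rep)

end

section \<open>Values of representations on words, and characters of the algebra\<close>

lemma (in suzuki_rep) hom_W: "hom (W c u) = tv c u"
  unfolding word_value_Alg[OF typed_lists] by (rule hom_word[OF typed_lists])

text \<open>The condition \<open>(i = j) \<noteq> d\<close> selects the generators of type
  \<open>d\<close>. On these it is the character \<open>a \<mapsto> \<alpha>\<close>,
  \<open>b \<mapsto> s \<alpha>\<close> of one copy of the group; the other copy is killed.\<close>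

definition char_gen :: "bool \<Rightarrow> 'k \<Rightarrow> 'k \<Rightarrow> gen \<Rightarrow> 'k::field" where
  "char_gen d \<alpha> s = (\<lambda>(i, j). if (i = j) \<noteq> d then (if i = 1 then \<alpha> else s * \<alpha>) else 0)"

lemma char_gen_letter:
  "char_gen d \<alpha> s (letter c \<beta>) = (if c = d then (if \<beta> then s * \<alpha> else \<alpha>) else 0)"
  by (cases c; cases \<beta>; cases d) (simp_all add: char_gen_def letter_def)

lemma char_gen_typed:
  "word_value scalars (char_gen d \<alpha> s) (typed c u) =
    (if c = d then \<alpha> ^ length u * s ^ length (filter (\<lambda>\<beta>. \<beta>) u) else of_bool (u = []))"
  by (induction u) (auto simp: char_gen_letter)

text \<open>For even \<open>n\<close> both alternating words contain \<open>n div 2\<close> letters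
  \<open>True\<close>, so a sign attached to that letter respects the alternating relation.\<close>

lemma filter_alternating:
  "length (filter (\<lambda>\<beta>. \<beta>) (alternating n False True)) = n div 2"
  "length (filter (\<lambda>\<beta>. \<beta>) (alternating n True False)) = Suc n div 2"
proof (induction n)
  case 0
  {
    case 1 show ?case by (simp add: alternating_def)
  next
    case 2 show ?case by (simp add: alternating_def)
  }
next
  case (Suc n)
  {
    case 1 show ?case by (simp add: alternating_Suc Suc)
  next
    case 2 show ?case by (simp add: alternating_Suc Suc)
  }
qed

context suzuki
begin

lemma char_rep:
  assumes "\<alpha> ^ (2 * N) = (1 :: 'k)" "s * s = 1"
  shows "suzuki_rep N n scalars (char_gen d \<alpha> s)"
proof (intro suzuki_rep.intro suzuki_rep_axioms.intro)
  show "suzuki N n" by unfold_locales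
  show "assoc_algebra (scalars :: ('k, 'k) module)" by (rule scalars_algebra)
  show "char_gen d \<alpha> s \<in> X \<rightarrow> carrier scalars" by simp
  have "s * \<alpha> * (s * \<alpha>) = (s * s) * (\<alpha> * \<alpha>)" by simp
  then have sa: "s * \<alpha> * (s * \<alpha>) = \<alpha> * \<alpha>" using assms(2) by simp
  fix c \<beta> \<beta>'
  show "char_gen d \<alpha> s (letter c \<beta>) \<otimes>\<^bsub>scalars\<^esub> char_gen d \<alpha> s (letter (\<not> c) \<beta>') = \<zero>\<^bsub>scalars\<^esub>"
    by (auto simp: char_gen_letter)
  show "char_gen d \<alpha> s (letter c True) \<otimes>\<^bsub>scalars\<^esub> char_gen d \<alpha> s (letter c True) =
      char_gen d \<alpha> s (letter c False) \<otimes>\<^bsub>scalars\<^esub> char_gen d \<alpha> s (letter c False)"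
    using sa by (simp add: char_gen_letter)
  have "filter (\<lambda>\<beta>. \<beta>) (replicate m False) = []" for m by (induction m) auto
  then show "word_value scalars (char_gen d \<alpha> s) (typed False (replicate (2 * N) False)) \<oplus>\<^bsub>scalars\<^esub>
      word_value scalars (char_gen d \<alpha> s) (typed True (replicate (2 * N) False)) = \<one>\<^bsub>scalars\<^esub>"
    using assms N by (simp add: char_gen_typed)
  show "word_value scalars (char_gen d \<alpha> s) (typed c (alternating n False True)) =
      word_value scalars (char_gen d \<alpha> s) (typed c (alternating n True False))"
    using even_n by (simp add: char_gen_typed filter_alternating alternating_not_Nil)
qed

section \<open>The algebra spanned by the classes\<close>

definition cls_monoid :: "(int \<times> int) monoid" where
  "cls_monoid = \<lparr>carrier = {0..<int (2 * N)} \<times> {0..<int n},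
    monoid.mult = (\<lambda>(l, r) (l', r').
      ((l + l') mod int (2 * N), (if even l then r + r' else r - r') mod int n)),
    one = (0, 0)\<rparr>"

abbreviation ClsAlg :: "('k, int \<times> int \<Rightarrow>\<^sub>0 'k) module" where "ClsAlg \<equiv> monoid_algebra cls_monoid"

lemma even_mod: "even (l mod int (2 * N)) \<longleftrightarrow> even l"
  by (rule dvd_mod_iff) simp

text \<open>Read \<open>(l, r)\<close> as \<open>\<rho>^r a^l\<close>: moving \<open>a^l\<close>
  past a power of \<open>\<rho>\<close> inverts that power exactly when \<open>l\<close> is odd.
  Reduction modulo \<open>2 * N\<close> preserves this parity, hence associativity.\<close>

lemma cls_monoid: "monoid cls_monoid"
proof (rule monoidI)
  fix p q r assume "p \<in> carrier cls_monoid" "q \<in> carrier cls_monoid" "r \<in> carrier cls_monoid"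
  show "p \<otimes>\<^bsub>cls_monoid\<^esub> q \<in> carrier cls_monoid"
    using N n by (auto simp: cls_monoid_def split: prod.splits)
  obtain l1 r1 l2 r2 l3 r3 where [simp]: "p = (l1, r1)" "q = (l2, r2)" "r = (l3, r3)"
    by (metis surj_pair)
  show "p \<otimes>\<^bsub>cls_monoid\<^esub> q \<otimes>\<^bsub>cls_monoid\<^esub> r = p \<otimes>\<^bsub>cls_monoid\<^esub> (q \<otimes>\<^bsub>cls_monoid\<^esub> r)"
    by (simp add: cls_monoid_def even_mod mod_simps del: of_nat_mult) (simp add: algebra_simps)
qed (use N n in \<open>auto simp: cls_monoid_def\<close>)

lemma cls_closed [simp]: "cls u \<in> carrier cls_monoid"
  using N n by (simp add: cls_def cls_monoid_def)

lemma cls_Nil: "cls [] = \<one>\<^bsub>cls_monoid\<^esub>"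
  by (simp add: cls_def cls_monoid_def)

text \<open>The head has length one, which is odd, so the product subtracts the second component
  just as the recursion of \<open>rot\<close> does.\<close>

lemma cls_Cons: "cls (\<beta> # u) = cls [\<beta>] \<otimes>\<^bsub>cls_monoid\<^esub> cls u"
proof -
  have "odd (1 mod int (2 * N))" using even_mod[of 1] by simp
  then show ?thesis
    by (simp add: cls_def cls_monoid_def mod_simps del: of_nat_mult)
qed

text \<open>The projection of \<open>Alg\<close> to one copy of the group algebra. It keeps distinct
  classes linearly independent, which complements the spanning statement
  \<open>Alg_induct\<close>.\<close>

definition cls_gen :: "bool \<Rightarrow> gen \<Rightarrow> (int \<times> int \<Rightarrow>\<^sub>0 'k)" where
  "cls_gen d = (\<lambda>(i, j). if (i = j) \<noteq> d then Poly_Mapping.single (cls [i = 2]) 1 else 0)"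

lemma cls_gen_letter:
  "cls_gen d (letter c \<beta>) = (if c = d then Poly_Mapping.single (cls [\<beta>]) 1 else 0)"
  by (cases c; cases \<beta>; cases d) (simp_all add: cls_gen_def letter_def)

lemma cls_gen_typed:
  "word_value ClsAlg (cls_gen d) (typed c u) =
    (if c = d \<or> u = [] then Poly_Mapping.single (cls u) 1 else 0)"
proof (induction u)
  case Nil
  show ?case by (simp add: cls_Nil)
next
  case (Cons \<beta> u)
  show ?case
    unfolding cls_Cons[of \<beta> u] typed_simps word_value_simps Cons cls_gen_letter by simp
qed

lemma cls_rep: "suzuki_rep N n ClsAlg (cls_gen d)"
proof (intro suzuki_rep.intro suzuki_rep_axioms.intro)
  show "suzuki N n" by unfold_locales
  show "assoc_algebra ClsAlg" by (rule monoid.monoid_algebra[OF cls_monoid])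
  have "cls_gen d (letter c \<beta>) \<in> carrier ClsAlg" for c \<beta>
    by (simp add: cls_gen_letter)
  then show "cls_gen d \<in> X \<rightarrow> carrier ClsAlg"
    by (metis Pi_I letter_cases)
  fix c \<beta> \<beta>'
  show "cls_gen d (letter c \<beta>) \<otimes>\<^bsub>ClsAlg\<^esub> cls_gen d (letter (\<not> c) \<beta>') = \<zero>\<^bsub>ClsAlg\<^esub>"
    by (simp add: cls_gen_letter)
  have "cls [True, True] = cls [False, False]" by (simp add: cls_def)
  then show "cls_gen d (letter c True) \<otimes>\<^bsub>ClsAlg\<^esub> cls_gen d (letter c True) =
      cls_gen d (letter c False) \<otimes>\<^bsub>ClsAlg\<^esub> cls_gen d (letter c False)"
    by (simp add: cls_gen_letter cls_Cons[of _ "[_]"])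
  have "cls (replicate (2 * N) False) = \<one>\<^bsub>cls_monoid\<^esub>"
    by (simp add: cls_def cls_monoid_def)
  then show "word_value ClsAlg (cls_gen d) (typed False (replicate (2 * N) False)) \<oplus>\<^bsub>ClsAlg\<^esub>
      word_value ClsAlg (cls_gen d) (typed True (replicate (2 * N) False)) = \<one>\<^bsub>ClsAlg\<^esub>"
    using N by (cases d) (simp_all add: cls_gen_typed)
  obtain m where m: "n = 2 * m" using even_n by blast
  \<comment> \<open>\<open>-m\<close> and \<open>m\<close> agree modulo \<open>n = 2 * m\<close>;
    this is how the evenness of \<open>n\<close> enters the alternating relation.\<close>
  have "- int m mod int n = int m mod int n"
    unfolding mod_eq_dvd_iff by (simp add: m)
  then have "cls (alternating n False True) = cls (alternating n True False)"
    unfolding cls_def rot_alternating length_alternating by (simp add: m)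
  then show "word_value ClsAlg (cls_gen d) (typed c (alternating n False True)) =
      word_value ClsAlg (cls_gen d) (typed c (alternating n True False))"
    by (simp add: cls_gen_typed alternating_not_Nil)
qed


subsection \<open>The dual algebra\<close>

text \<open>A coordinate of the projection \<open>cls_gen d\<close>; for classes of nonempty words
  these are the forms dual to the spanning words. Restriction to the carrier gives the extensional
  functions that \<open>linear_forms\<close> consists of.\<close>

definition indicator_form :: "bool \<Rightarrow> int \<times> int \<Rightarrow> (gen list \<Rightarrow>\<^sub>0 'k) set \<Rightarrow> 'k" where
  "indicator_form d g = (\<lambda>a\<in>carrier Alg. Poly_Mapping.lookup (presented_hom ClsAlg (cls_gen d) a) g)"

definition char_form :: "bool \<Rightarrow> 'k \<Rightarrow> 'k \<Rightarrow> (gen list \<Rightarrow>\<^sub>0 'k) set \<Rightarrow> 'k" where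
  "char_form d \<alpha> s = (\<lambda>a\<in>carrier Alg. presented_hom scalars (char_gen d \<alpha> s) a)"

text \<open>The product of \<open>dual_algebra\<close>, with the coproduct written as a map out of
  the presentation; \<open>dual_simps\<close> makes the identification.\<close>

definition conv :: "((gen list \<Rightarrow>\<^sub>0 'k) set \<Rightarrow> 'k) \<Rightarrow> ((gen list \<Rightarrow>\<^sub>0 'k) set \<Rightarrow> 'k)
    \<Rightarrow> (gen list \<Rightarrow>\<^sub>0 'k) set \<Rightarrow> 'k" where
  "conv f g = (\<lambda>a\<in>carrier Alg. tensor_form f g (presented_hom Tensor comult_gen a))"

abbreviation "L \<equiv> linear_forms Alg"

lemma indicator_form: "indicator_form d g \<in> L"
proof -
  interpret r: suzuki_rep N n kt ClsAlg "cls_gen d" by (rule cls_rep)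
  show ?thesis
    unfolding linear_forms_def indicator_form_def
    by (auto simp: r.hom_add r.hom_smult lookup_add)
qed

lemma indicator_form_W:
  assumes "u \<noteq> []"
  shows "indicator_form d g (W c u) = of_bool (c = d \<and> cls u = g)"
proof -
  interpret r: suzuki_rep N n kt ClsAlg "cls_gen d" by (rule cls_rep)
  have "indicator_form d g (W c u) = Poly_Mapping.lookup (word_value ClsAlg (cls_gen d) (typed c u)) g"
    unfolding indicator_form_def restrict_apply'[OF self.tv_closed] r.hom_W ..
  then show ?thesis using assms by (simp add: cls_gen_typed lookup_single when_def)
qed

lemma char_form:
  assumes "\<alpha> ^ (2 * N) = 1" "s * s = 1"
  shows "char_form d \<alpha> s \<in> L"
proof -
  interpret r: suzuki_rep N n kt scalars "char_gen d \<alpha> s" using assms by (rule char_rep)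
  show ?thesis
    unfolding linear_forms_def char_form_def
    by (auto simp: r.hom_add r.hom_smult)
qed

lemma char_form_W:
  assumes "\<alpha> ^ (2 * N) = 1" "s * s = 1" "u \<noteq> []"
  shows "char_form d \<alpha> s (W c u) = (if c = d then \<alpha> ^ length u * s ^ length (filter (\<lambda>\<beta>. \<beta>) u) else 0)"
proof -
  interpret r: suzuki_rep N n kt scalars "char_gen d \<alpha> s" using assms(1,2) by (rule char_rep)
  have "char_form d \<alpha> s (W c u) = word_value scalars (char_gen d \<alpha> s) (typed c u)"
    unfolding char_form_def restrict_apply'[OF self.tv_closed] r.hom_W ..
  then show ?thesis using assms by (simp add: char_gen_typed)
qed

lemma conv:
  assumes "f \<in> L" "g \<in> L"
  shows "conv f g \<in> L"
  unfolding linear_forms_def conv_def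
  by (auto simp: \<Delta>.hom_add \<Delta>.hom_smult pair.tensor_form_linear(1)[OF assms]
      pair.tensor_form_linear(2)[OF assms _ T.zero_closed])

lemma conv_W:
  assumes "f \<in> L" "g \<in> L" "u \<noteq> []"
  shows "conv f g (W c u) = f (W False u) * g (W c u) + f (W True u) * g (W (\<not> c) (map Not u))"
  unfolding conv_def restrict_apply'[OF self.tv_closed] \<Delta>.hom_W word_value_comult[OF assms(3)]
    pair.tensor_form_linear(1)[OF assms(1,2) pure_closed pure_closed]
    pair.tensor_form_pure[OF assms(1,2) self.tv_closed self.tv_closed] ..

text \<open>Nonempty words of a single type span \<open>Alg\<close>, so identities in the dual can
  be checked on them with \<open>conv_W\<close>.\<close>

lemma linear_form_eqI:
  assumes f: "f \<in> L" and g: "g \<in> L" and eq: "\<And>c u. u \<noteq> [] \<Longrightarrow> f (W c u) = g (W c u)"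
  shows "f = g"
proof (rule extensionalityI)
  show "f \<in> extensional (carrier Alg)" "g \<in> extensional (carrier Alg)"
    using f g by (auto simp: linear_forms_def PiE_def)
  fix a assume "a \<in> carrier Alg"
  have form_zero: "h \<zero>\<^bsub>Alg\<^esub> = 0" if "h \<in> L" for h
  proof -
    have "h (0 \<odot>\<^bsub>Alg\<^esub> \<zero>\<^bsub>Alg\<^esub>) = 0 * h \<zero>\<^bsub>Alg\<^esub>"
      using that Alg.zero_closed unfolding linear_forms_def by blast
    then show ?thesis by simp
  qed
  from \<open>a \<in> carrier Alg\<close> show "f a = g a"
  proof (induction a rule: Alg_induct)
    case zero
    show ?case using form_zero[OF f] form_zero[OF g] by simp
  qed (use f g eq in \<open>auto simp: linear_forms_def\<close>)
qed

lemma add_form: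
  assumes "f \<in> L" "g \<in> L"
  shows "(\<lambda>a\<in>carrier Alg. f a + g a) \<in> L"
  using assms by (auto simp: linear_forms_def algebra_simps)

lemma smult_form:
  assumes "f \<in> L"
  shows "(\<lambda>a\<in>carrier Alg. c * f a) \<in> L"
  using assms by (auto simp: linear_forms_def algebra_simps)

end

lemma map_Not_Not: "map Not (map Not u) = u"
  by (induction u) auto

section \<open>Unit and sign of the dual algebra, and the exchange of the letters on classes\<close>

context suzuki
begin

text \<open>\<open>counit_form\<close> is the unit of the dual algebra. \<open>sign_form\<close>
  squares to it and plays the role of the group element of order two in the crossed product.\<close>

abbreviation "counit_form \<equiv> char_form False 1 1"
abbreviation "sign_form \<equiv> char_form True 1 1"

lemma counit_form: "counit_form \<in> L" and sign_form: "sign_form \<in> L"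
  by (auto intro: char_form)

lemma counit_form_W: "u \<noteq> [] \<Longrightarrow> counit_form (W c u) = of_bool (\<not> c)"
  and sign_form_W: "u \<noteq> [] \<Longrightarrow> sign_form (W c u) = of_bool c"
  by (simp_all add: char_form_W)

text \<open>By \<open>rot_map_Not\<close> the effect of the exchange depends on the parity of the
  length, which is determined modulo \<open>2 * N\<close>.\<close>

lemma cls_map_Not:
  assumes "cls u = cls w"
  shows "cls (map Not u) = cls (map Not w)"
proof -
  have len: "int (length u) mod int (2 * N) = int (length w) mod int (2 * N)"
    and rot: "rot u mod int n = rot w mod int n"
    using assms by (simp_all add: cls_def)
  have "even (length u) = even (length w)"
    using len even_mod[of "int (length u)"] even_mod[of "int (length w)"] by simp
  then show ?thesis
    using len mod_diff_cong[OF refl rot] by (simp add: cls_def rot_map_Not)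
qed

lemma cls_map_Not_iff: "cls (map Not u) = cls w \<longleftrightarrow> cls u = cls (map Not w)"
  using cls_map_Not[of "map Not u" w, unfolded map_Not_Not]
    cls_map_Not[of u "map Not w", unfolded map_Not_Not] by (rule iffI)

lemma W_cls:
  assumes "f \<in> L" "u \<noteq> []" "w \<noteq> []" "cls u = cls w"
  shows "f (W c u) = f (W c w)"
  using W_eq[OF assms(2-4)] by simp

text \<open>The classes fixed by the exchange of the two letters.\<close>

definition fixed_classes :: "(int \<times> int) set" where
  "fixed_classes = (\<lambda>i. 2 * int i) ` {..<N} \<times> {0, int n div 2}"

lemma card_fixed_classes: "finite fixed_classes" "card fixed_classes \<le> 2 * N"
proof -
  have "card ((\<lambda>i. 2 * int i) ` {..<N}) \<le> N"
    using card_image_le[of "{..<N}" "\<lambda>i. 2 * int i"] by simp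
  moreover have "card {0, int n div 2} \<le> 2"
    by (simp add: card_insert_if)
  ultimately have "card ((\<lambda>i. 2 * int i) ` {..<N}) * card {0, int n div 2} \<le> N * 2"
    by (rule mult_le_mono)
  then show "finite fixed_classes" "card fixed_classes \<le> 2 * N"
    by (simp_all add: fixed_classes_def card_cartesian_product mult.commute)
qed

text \<open>With \<open>b\<close> the parity of the length, a fixed class means that
  \<open>n\<close> divides \<open>b - 2 * rot u\<close>. Even \<open>n\<close> forces
  \<open>b = 0\<close>, so the length is even, and then \<open>n div 2\<close> divides
  \<open>rot u\<close>.\<close>

lemma fixed_classesI:
  assumes "cls (map Not u) = cls u"
  shows "cls u \<in> fixed_classes"
proof -
  let ?b = "of_bool (odd (length u)) :: int"
  have "(?b - rot u) mod int n = rot u mod int n"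
    using assms by (simp add: cls_def rot_map_Not)
  then have "int n dvd ?b - rot u - rot u" by (simp add: mod_eq_dvd_iff)
  then have n_dvd: "int n dvd ?b - 2 * rot u" by (simp add: algebra_simps)
  have "even (int n)" using even_n by simp
  then have "even (?b - 2 * rot u)" using n_dvd by (rule dvd_trans)
  then have even: "even (length u)" by (cases "even (length u)") auto
  obtain m where m: "n = 2 * m" using even_n by blast
  have "2 * int m dvd 2 * rot u" using n_dvd even m by simp
  then have "int m dvd rot u" by simp
  then obtain k where k: "rot u = int m * k" by blast
  have "int n = int m * 2" using m by simp
  then have "rot u mod int n = int m * (k mod 2)"
    unfolding k by (simp only: mult_mod_right)
  moreover have "k mod 2 = 0 \<or> k mod 2 = 1" by presburger
  ultimately have r: "rot u mod int n \<in> {0, int n div 2}" by (auto simp: m)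
  obtain l where l: "length u = 2 * l" using even by blast
  have "int (length u) mod int (2 * N) = int (2 * (l mod N))"
    unfolding l mult_mod_right by (rule zmod_int[symmetric])
  then have "int (length u) mod int (2 * N) = 2 * int (l mod N)" by simp
  moreover have "l mod N < N" using N by simp
  ultimately show ?thesis
    using r unfolding cls_def fixed_classes_def by blast
qed

end

subsection \<open>Characters of the dual algebra\<close>

text \<open>The conditions on an algebra map from the dual algebra to the ground field, with the
  operations written out as in \<open>dual_simps\<close>.\<close>

locale dual_char = suzuki N n kt for N n and kt :: "'k::field itself" +
  fixes \<xi> :: "((gen list \<Rightarrow>\<^sub>0 'k) set \<Rightarrow> 'k) \<Rightarrow> 'k"
  assumes add: "f \<in> L \<Longrightarrow> g \<in> L \<Longrightarrow> \<xi> (\<lambda>a\<in>carrier Alg. f a + g a) = \<xi> f + \<xi> g"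
    and smult: "f \<in> L \<Longrightarrow> \<xi> (\<lambda>a\<in>carrier Alg. c * f a) = c * \<xi> f"
    and mult: "f \<in> L \<Longrightarrow> g \<in> L \<Longrightarrow> \<xi> (conv f g) = \<xi> f * \<xi> g"
    and one: "\<xi> counit_form = 1"
begin

lemma sum_indicator_forms:
  assumes "finite S"
  shows "(\<lambda>a\<in>carrier Alg. \<Sum>g\<in>S. indicator_form False g a) \<in> L"
    and "\<xi> (\<lambda>a\<in>carrier Alg. \<Sum>g\<in>S. indicator_form False g a) = (\<Sum>g\<in>S. \<xi> (indicator_form False g))"
proof -
  let ?s = "\<lambda>S. \<lambda>a\<in>carrier Alg. \<Sum>g\<in>S. indicator_form False g a"
  have "?s S \<in> L \<and> \<xi> (?s S) = (\<Sum>g\<in>S. \<xi> (indicator_form False g))"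
    using assms
  proof (induction S)
    case empty
    \<comment> \<open>The zero form is expressed as a scalar multiple, so that \<open>smult\<close>
      yields its value.\<close>
    have "?s {} = (\<lambda>a\<in>carrier Alg. 0 * counit_form a)" by simp
    then show ?case
      using smult_form[OF counit_form, of 0] smult[OF counit_form, of 0]
      by (simp only: mult_zero_left sum.empty simp_thms)
  next
    case (insert g S)
    from insert.IH have IH: "?s S \<in> L" "\<xi> (?s S) = (\<Sum>g\<in>S. \<xi> (indicator_form False g))" by blast+
    have eq: "?s (insert g S) = (\<lambda>a\<in>carrier Alg. indicator_form False g a + ?s S a)"
      using insert by (intro restrict_ext) simp
    have "?s (insert g S) \<in> L"
      unfolding eq by (rule add_form[OF indicator_form IH(1)])
    moreover have "\<xi> (?s (insert g S)) = (\<Sum>g\<in>insert g S. \<xi> (indicator_form False g))"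
      unfolding eq add[OF indicator_form IH(1)] IH(2) using insert.hyps by simp
    ultimately show ?case by blast
  qed
  then show "?s S \<in> L" "\<xi> (?s S) = (\<Sum>g\<in>S. \<xi> (indicator_form False g))" by blast+
qed

text \<open>The unit of the dual is the sum of these forms over all classes, and a character takes
  the value 1 there.\<close>

lemma ex_indicator_form: "\<exists>g. \<xi> (indicator_form False g) \<noteq> 0"
proof (rule ccontr)
  assume "\<not> ?thesis"
  then have zero: "\<xi> (indicator_form False g) = 0" for g by blast
  have fin: "finite (carrier cls_monoid)" by (simp add: cls_monoid_def)
  have "counit_form = (\<lambda>a\<in>carrier Alg. \<Sum>g\<in>carrier cls_monoid. indicator_form False g a)"
  proof (rule linear_form_eqI[OF counit_form sum_indicator_forms(1)[OF fin]])
    fix c and u :: "bool list" assume u: "u \<noteq> []"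
    have "(\<Sum>g\<in>carrier cls_monoid. indicator_form False g (W c u)) =
        (\<Sum>g\<in>carrier cls_monoid. if cls u = g then of_bool (\<not> c) else 0)"
      using u by (intro sum.cong) (auto simp: indicator_form_W)
    also have "\<dots> = of_bool (\<not> c)" using fin by simp
    finally show "counit_form (W c u) =
        (\<lambda>a\<in>carrier Alg. \<Sum>g\<in>carrier cls_monoid. indicator_form False g a) (W c u)"
      using u by (simp only: counit_form_W[OF u] restrict_apply' self.tv_closed)
  qed
  then show False
    using one sum_indicator_forms(2)[OF fin] by (simp add: zero)
qed

text \<open>A character of the dual algebra takes the value 1 at a single idempotent
  \<open>indicator_form False g\<close>; multiplying by \<open>sign_form\<close> on either side shows that \<open>g\<close> is a fixed class.\<close>

lemma char_formula:
  obtains u where "u \<noteq> []" "cls u \<in> fixed_classes" "\<xi> sign_form = 1 \<or> \<xi> sign_form = - 1"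
    "\<And>f. f \<in> L \<Longrightarrow> \<xi> f = f (W False u) + f (W True u) * \<xi> sign_form"
proof -
  let ?e = "indicator_form False" and ?t = sign_form
  obtain g where g: "\<xi> (?e g) \<noteq> 0" using ex_indicator_form by blast
  \<comment> \<open>The forms \<open>?e g\<close> are orthogonal idempotents, so a character takes
    only the values 0 and 1 on them, and the value 1 at most once.\<close>
  have mult_e: "conv (?e g) (?e h) = (\<lambda>a\<in>carrier Alg. of_bool (g = h) * ?e g a)" for g h
    by (rule linear_form_eqI[OF conv[OF indicator_form indicator_form] smult_form[OF indicator_form]])
      (auto simp: conv_W indicator_form indicator_form_W self.tv_closed)
  have xi_mult_e: "\<xi> (?e g) * \<xi> (?e h) = of_bool (g = h) * \<xi> (?e g)" for g h
    unfolding mult[OF indicator_form indicator_form, symmetric] mult_e by (rule smult[OF indicator_form])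
  have eg: "\<xi> (?e g) = 1"
    using xi_mult_e[of g g] g by simp
  \<comment> \<open>If no nonempty word had class \<open>g\<close>, the form would be zero and
    \<open>\<xi>\<close> would vanish on it.\<close>
  have "\<exists>u. u \<noteq> [] \<and> cls u = g"
  proof (rule ccontr)
    assume "\<not> ?thesis"
    then have "?e g = (\<lambda>a\<in>carrier Alg. 0 * counit_form a)"
      by (intro linear_form_eqI[OF indicator_form smult_form[OF counit_form]])
        (auto simp: indicator_form_W self.tv_closed)
    then show False using g smult[OF counit_form, of 0] by simp
  qed
  then obtain u where u: "u \<noteq> []" "cls u = g" by blast
  have "conv ?t ?t = counit_form"
    by (rule linear_form_eqI[OF conv[OF sign_form sign_form] counit_form])
      (auto simp: conv_W sign_form sign_form_W counit_form_W)
  then have "\<xi> ?t * \<xi> ?t = 1" using mult[OF sign_form sign_form] one by simp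
  then have sign: "\<xi> ?t = 1 \<or> \<xi> ?t = - 1" by (simp add: square_eq_1_iff)
  have "conv (?e g) ?t = indicator_form True g"
    by (rule linear_form_eqI[OF conv[OF indicator_form sign_form] indicator_form])
      (auto simp: conv_W indicator_form sign_form sign_form_W indicator_form_W)
  then have ft: "\<xi> (indicator_form True g) = \<xi> ?t"
    using mult[OF indicator_form sign_form, of False g] eg by simp
  \<comment> \<open>\<open>h\<close> is the image of \<open>g\<close> under the exchange of letters.
    Multiplying \<open>?e h\<close> by \<open>sign_form\<close> on the left equals multiplying
    \<open>?e g\<close> by it on the right, so both idempotents have value 1 and orthogonality
    forces \<open>g = h\<close>.\<close>
  define h where "h = cls (map Not u)"
  have h: "cls (map Not w) = h \<longleftrightarrow> cls w = g" for w
    using cls_map_Not_iff[of w "map Not u", unfolded map_Not_Not] u(2) by (simp only: h_def)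
  have "conv ?t (?e h) = indicator_form True g"
    by (rule linear_form_eqI[OF conv[OF sign_form indicator_form] indicator_form])
      (auto simp: conv_W indicator_form sign_form sign_form_W indicator_form_W h)
  then have "\<xi> ?t * \<xi> (?e h) = \<xi> ?t"
    using mult[OF sign_form indicator_form, of False h] ft by simp
  then have eh: "\<xi> (?e h) = 1" using sign by auto
  have "g = h" using xi_mult_e[of g h] eg eh by (simp split: if_splits)
  then have fixed: "cls (map Not u) = cls u" using u h_def by simp
  have "\<xi> f = f (W False u) + f (W True u) * \<xi> ?t" if f: "f \<in> L" for f
  proof -
    \<comment> \<open>On the part of a fixed class, a form acts through its two values at that
      class: \<open>f\<close> times the idempotent is a combination of the idempotent and of its
      product with \<open>sign_form\<close>.\<close>
    let ?r = "\<lambda>a\<in>carrier Alg. (\<lambda>a\<in>carrier Alg. f (W False u) * ?e g a) a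
      + (\<lambda>a\<in>carrier Alg. f (W True u) * indicator_form True g a) a"
    have conv_eq: "conv f (?e g) = ?r"
    proof (rule linear_form_eqI[OF conv[OF f indicator_form]
          add_form[OF smult_form[OF indicator_form] smult_form[OF indicator_form]]])
      fix c and w :: "bool list" assume w: "w \<noteq> []"
      have "cls (map Not w) = g \<longleftrightarrow> cls w = g"
        using fixed u(2) cls_map_Not_iff[of w u] by simp
      moreover have "f (W c w) = f (W c u)" if "cls w = g"
        using W_cls[OF f w u(1)] that u(2) by simp
      ultimately show "conv f (?e g) (W c w) = ?r (W c w)"
        using w by (cases c) (auto simp: conv_W f indicator_form indicator_form_W self.tv_closed)
    qed
    have "\<xi> f * \<xi> (?e g) = \<xi> ?r"
      unfolding mult[OF f indicator_form, symmetric] conv_eq ..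
    also have "\<dots> = f (W False u) * \<xi> (?e g) + f (W True u) * \<xi> (indicator_form True g)"
      by (simp only: add[OF smult_form[OF indicator_form] smult_form[OF indicator_form]] smult[OF indicator_form])
    finally show ?thesis by (simp add: eg ft)
  qed
  then show ?thesis
    using that[OF u(1) fixed_classesI[OF fixed] sign] by blast
qed

end

section \<open>Comparison of the characters of the algebra and of its dual\<close>

context suzuki
begin

abbreviation "H \<equiv> suzuki_hopf N n (1 :: 'k) 1"

lemma hopf_simps:
  "carrier H = carrier Alg" "monoid.mult H = monoid.mult Alg" "one H = one Alg" "add H = add Alg"
  "smult H = smult Alg" "comult H = presented_hom Tensor comult_gen"
  "counit H = presented_hom scalars (char_gen False 1 1)"
  by (simp_all add: suzuki_hopf_def Let_def module.defs hopf_algebra.defs comult_gen_def char_gen_def)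
    (rule arg_cong[where f = "presented_hom scalars"], auto)

lemma linear_forms_hopf: "linear_forms H = L"
  unfolding linear_forms_def hopf_simps ..

lemma dual_simps:
  "carrier (dual_hopf H) = L"
  "f \<otimes>\<^bsub>dual_hopf H\<^esub> g = conv f g"
  "f \<oplus>\<^bsub>dual_hopf H\<^esub> g = (\<lambda>a\<in>carrier Alg. f a + g a)"
  "c \<odot>\<^bsub>dual_hopf H\<^esub> f = (\<lambda>a\<in>carrier Alg. c * f a)"
  "\<one>\<^bsub>dual_hopf H\<^esub> = counit_form"
  by (simp_all add: dual_hopf_def module.defs dual_algebra_def linear_forms_hopf hopf_simps conv_def
      char_form_def)

text \<open>At the letter \<open>False\<close> of type \<open>d\<close> the value is
  \<open>\<alpha>\<close>, which is nonzero, so the type and \<open>\<alpha>\<close> are recovered;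
  the letter \<open>True\<close> then gives \<open>s\<close>.\<close>

lemma char_form_inj:
  assumes \<alpha>: "\<alpha> ^ (2 * N) = 1" "\<alpha>' ^ (2 * N) = 1" and s: "s * s = 1" "s' * s' = 1"
    and eq: "\<And>a. a \<in> carrier Alg \<Longrightarrow> char_form d \<alpha> s a = char_form d' \<alpha>' s' a"
  shows "d = d' \<and> \<alpha> = \<alpha>' \<and> s = s'"
proof -
  have "\<alpha> \<noteq> 0" using \<alpha> N by (intro notI) (simp add: power_0_left)
  have *: "char_form d \<alpha> s (W d [\<beta>]) = char_form d' \<alpha>' s' (W d [\<beta>])" for \<beta>
    by (intro eq self.tv_closed)
  have d: "d = d'" and a: "\<alpha> = \<alpha>'"
    using *[of False] \<open>\<alpha> \<noteq> 0\<close> unfolding char_form_W[OF \<alpha>(1) s(1) not_Cons_self2]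
      char_form_W[OF \<alpha>(2) s(2) not_Cons_self2] by (auto split: if_splits)
  moreover have "s = s'"
    using *[of True] \<open>\<alpha> \<noteq> 0\<close> d a unfolding char_form_W[OF \<alpha>(1) s(1) not_Cons_self2]
      char_form_W[OF \<alpha>(2) s(2) not_Cons_self2] by auto
  ultimately show ?thesis by blast
qed

lemma char_form_mult:
  assumes "\<alpha> ^ (2 * N) = 1" "s * s = 1" "a \<in> carrier Alg" "b \<in> carrier Alg"
  shows "char_form d \<alpha> s (a \<otimes>\<^bsub>Alg\<^esub> b) = char_form d \<alpha> s a * char_form d \<alpha> s b"
    and "char_form d \<alpha> s \<one>\<^bsub>Alg\<^esub> = 1"
proof -
  interpret r: suzuki_rep N n kt scalars "char_gen d \<alpha> s" using assms(1,2) by (rule char_rep)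
  show "char_form d \<alpha> s (a \<otimes>\<^bsub>Alg\<^esub> b) = char_form d \<alpha> s a * char_form d \<alpha> s b"
    "char_form d \<alpha> s \<one>\<^bsub>Alg\<^esub> = 1"
    using r.hom_mult[OF assms(3,4)] r.hom_one assms(3,4) by (simp_all add: char_form_def)
qed

text \<open>The powers of \<open>\<omega>\<close> provide \<open>2 * N\<close> values of
  \<open>\<alpha>\<close>. An isomorphism carries the resulting characters to the dual, where
  \<open>char_formula\<close> leaves too little room for them.\<close>

lemma not_self_dual:
  assumes \<omega>: "\<omega> ^ (2 * N) = (1 :: 'k)" "inj_on (\<lambda>i. \<omega> ^ i) {..<2 * N}" and char: "(1 :: 'k) \<noteq> - 1"
  shows "\<not> self_dual H"
proof
  assume "self_dual H"
  then obtain h where iso: "h \<in> ring_iso H (dual_hopf H)"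
    and smult': "\<And>c a. a \<in> carrier H \<Longrightarrow> h (c \<odot>\<^bsub>H\<^esub> a) = c \<odot>\<^bsub>dual_hopf H\<^esub> h a"
    unfolding self_dual_def hopf_iso_def by blast
  from iso have hom: "h \<in> ring_hom H (dual_hopf H)" and bij: "bij_betw h (carrier Alg) L"
    by (simp_all add: ring_iso_def hopf_simps dual_simps)
  have h: "h a \<in> L" if "a \<in> carrier Alg" for a
    using bij that by (auto simp: bij_betw_def)
  have h_add: "h (a \<oplus>\<^bsub>Alg\<^esub> b) = (\<lambda>x\<in>carrier Alg. h a x + h b x)"
    and h_mult: "h (a \<otimes>\<^bsub>Alg\<^esub> b) = conv (h a) (h b)" if "a \<in> carrier Alg" "b \<in> carrier Alg" for a b
    using ring_hom_add[OF hom, of a b] ring_hom_mult[OF hom, of a b] that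
    by (simp_all only: hopf_simps dual_simps)
  have h_smult: "h (c \<odot>\<^bsub>Alg\<^esub> a) = (\<lambda>x\<in>carrier Alg. c * h a x)" if "a \<in> carrier Alg" for c a
    using smult'[of a c] that by (simp only: hopf_simps dual_simps)
  have h_one: "h \<one>\<^bsub>Alg\<^esub> = counit_form"
    using ring_hom_one[OF hom] by (simp only: hopf_simps dual_simps)
  define h' where "h' = inv_into (carrier Alg) h"
  have h'h: "h' (h a) = a" if "a \<in> carrier Alg" for a
    using bij that unfolding h'_def bij_betw_def by (intro inv_into_f_f) auto
  have h': "h' f \<in> carrier Alg" "h (h' f) = f" if "f \<in> L" for f
    using bij that unfolding h'_def bij_betw_def by (auto intro: inv_into_into f_inv_into_f)
  define R where "R = (\<lambda>i. \<omega> ^ i) ` {..<2 * N}"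
  define S where "S = {1 :: 'k, - 1}"
  \<comment> \<open>A character of \<open>Alg\<close>, pulled back along the inverse of the
    isomorphism, becomes a character of the dual.\<close>
  define \<xi> where "\<xi> = (\<lambda>(d, \<alpha>, s) f. char_form d \<alpha> s (h' f))"
  have R: "\<alpha> ^ (2 * N) = 1" if \<alpha>: "\<alpha> \<in> R" for \<alpha>
  proof -
    obtain i where "\<alpha> = \<omega> ^ i" using \<alpha> by (auto simp: R_def)
    then show ?thesis using \<omega>(1) by (metis mult.commute power_mult power_one)
  qed
  have S: "s * s = 1" if "s \<in> S" for s
    using that by (auto simp: S_def)
  have dual_char: "dual_char N n (\<xi> (d, \<alpha>, s))" if "\<alpha> \<in> R" "s \<in> S" for d \<alpha> s
  proof (intro dual_char.intro dual_char_axioms.intro)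
    show "suzuki N n" by unfold_locales
    note \<alpha>s = R[OF that(1)] S[OF that(2)]
    have linear: "char_form d \<alpha> s (a \<oplus>\<^bsub>Alg\<^esub> b) = char_form d \<alpha> s a + char_form d \<alpha> s b"
      "char_form d \<alpha> s (c \<odot>\<^bsub>Alg\<^esub> a) = c * char_form d \<alpha> s a"
      if "a \<in> carrier Alg" "b \<in> carrier Alg" for a b c
      using char_form[OF \<alpha>s, of d] that unfolding linear_forms_def by blast+
    fix f g c assume f: "f \<in> L"
    have "(\<lambda>a\<in>carrier Alg. c * f a) = h (c \<odot>\<^bsub>Alg\<^esub> h' f)"
      using h_smult h' f by simp
    then show "\<xi> (d, \<alpha>, s) (\<lambda>a\<in>carrier Alg. c * f a) = c * \<xi> (d, \<alpha>, s) f"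
      using h'h h'(1)[OF f] linear(2)[OF h'(1)[OF f] h'(1)[OF f]] by (simp add: \<xi>_def)
    assume g: "g \<in> L"
    have "(\<lambda>a\<in>carrier Alg. f a + g a) = h (h' f \<oplus>\<^bsub>Alg\<^esub> h' g)"
      using h_add h' f g by simp
    then show "\<xi> (d, \<alpha>, s) (\<lambda>a\<in>carrier Alg. f a + g a) = \<xi> (d, \<alpha>, s) f + \<xi> (d, \<alpha>, s) g"
      using h'h h'(1)[OF f] h'(1)[OF g] linear(1) by (simp add: \<xi>_def)
    have "conv f g = h (h' f \<otimes>\<^bsub>Alg\<^esub> h' g)"
      using h_mult h' f g by simp
    then show "\<xi> (d, \<alpha>, s) (conv f g) = \<xi> (d, \<alpha>, s) f * \<xi> (d, \<alpha>, s) g"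
      using h'h h'(1)[OF f] h'(1)[OF g] char_form_mult(1)[OF \<alpha>s] by (simp add: \<xi>_def)
  next
    show "\<xi> (d, \<alpha>, s) counit_form = 1"
      using h'h[OF Alg.one_closed] char_form_mult(2)[OF R[OF that(1)] S[OF that(2)] Alg.one_closed Alg.one_closed]
      by (simp add: \<xi>_def h_one)
  qed
  \<comment> \<open>\<open>char_formula\<close> supplies some word of a fixed class. A chosen
    representative makes the formula depend on the class and the sign alone.\<close>
  define rep where "rep = (\<lambda>g. SOME u. u \<noteq> [] \<and> cls u = g)"
  define P where "P = (UNIV :: bool set) \<times> R \<times> S"
  have "\<exists>y\<in>fixed_classes \<times> S. \<forall>f\<in>L. \<xi> p f = f (W False (rep (fst y))) + f (W True (rep (fst y))) * snd y"
    if p: "p \<in> P" for p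
  proof -
    obtain d \<alpha> s where [simp]: "p = (d, \<alpha>, s)" and "\<alpha> \<in> R" "s \<in> S" using p by (auto simp: P_def)
    then interpret dual_char N n kt "\<xi> p" using dual_char by simp
    obtain u where u: "u \<noteq> []" "cls u \<in> fixed_classes" "\<xi> p sign_form = 1 \<or> \<xi> p sign_form = - 1"
      "\<And>f. f \<in> L \<Longrightarrow> \<xi> p f = f (W False u) + f (W True u) * \<xi> p sign_form"
      by (rule char_formula) (erule (2) that, blast)
    have "rep (cls u) \<noteq> [] \<and> cls (rep (cls u)) = cls u"
      unfolding rep_def by (rule someI[of _ u]) (simp add: u(1))
    then have "W c (rep (cls u)) = W c u" for c
      using W_eq u(1) by blast
    then show ?thesis
      using u by (intro bexI[of _ "(cls u, \<xi> p sign_form)"]) (auto simp: S_def)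
  qed
  then obtain \<kappa> where \<kappa>: "\<And>p. p \<in> P \<Longrightarrow> \<kappa> p \<in> fixed_classes \<times> S"
    "\<And>p f. p \<in> P \<Longrightarrow> f \<in> L \<Longrightarrow>
      \<xi> p f = f (W False (rep (fst (\<kappa> p)))) + f (W True (rep (fst (\<kappa> p)))) * snd (\<kappa> p)"
    by metis
  \<comment> \<open>\<open>\<kappa> p\<close> determines \<open>\<xi> p\<close> on all of
    \<open>L\<close>; evaluation at \<open>h a\<close> recovers the original character of
    \<open>Alg\<close> at \<open>a\<close>.\<close>
  have "inj_on \<kappa> P"
  proof (rule inj_onI)
    fix p q assume p: "p \<in> P" and q: "q \<in> P" and eq: "\<kappa> p = \<kappa> q"
    obtain d \<alpha> s where dp: "p = (d, \<alpha>, s)" "\<alpha> \<in> R" "s \<in> S" using p by (auto simp: P_def)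
    obtain d' \<alpha>' s' where dq: "q = (d', \<alpha>', s')" "\<alpha>' \<in> R" "s' \<in> S" using q by (auto simp: P_def)
    have "char_form d \<alpha> s a = char_form d' \<alpha>' s' a" if a: "a \<in> carrier Alg" for a
    proof -
      have "\<xi> p (h a) = \<xi> q (h a)" using \<kappa>(2)[OF p h[OF a]] \<kappa>(2)[OF q h[OF a]] eq by simp
      then show ?thesis by (simp add: dp dq \<xi>_def h'h[OF a])
    qed
    then show "p = q"
      using char_form_inj[OF R[OF dp(2)] R[OF dq(2)] S[OF dp(3)] S[OF dq(3)]] dp dq by blast
  qed
  moreover have "\<kappa> ` P \<subseteq> fixed_classes \<times> S" using \<kappa>(1) by blast
  moreover have "finite (fixed_classes \<times> S)" using card_fixed_classes by (simp add: S_def)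
  ultimately have "card P \<le> card (fixed_classes \<times> S)" by (rule card_inj_on_le)
  moreover have cS: "card S = 2" using char by (simp add: S_def)
  moreover have "card R = 2 * N" unfolding R_def card_image[OF \<omega>(2)] by simp
  \<comment> \<open>Two types, \<open>2 * N\<close> values of \<open>\<alpha>\<close> and two signs
    make \<open>8 * N\<close> characters, against at most \<open>4 * N\<close> pairs of a fixed
    class and a sign.\<close>
  ultimately have "2 * (2 * N * 2) \<le> card fixed_classes * 2"
    by (simp add: P_def card_cartesian_product)
  then show False using card_fixed_classes(2) N by simp
qed

end

theorem proposition6p12:
  fixes N n :: nat
  assumes "N \<ge> 1" and "odd N" and "n \<ge> 2"
    and "\<not> CHAR('k::field) dvd 2 * n * N"
    and "\<exists>\<zeta>::'k. primitive_root_of_unity (4 * n * N) \<zeta>"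
    and "even n"
  shows "\<not> self_dual (suzuki_hopf N n (1::'k) 1)"
proof -
  interpret suzuki N n "TYPE('k)" using assms by unfold_locales
  obtain \<zeta> :: 'k where \<zeta>: "\<zeta> ^ (4 * n * N) = 1" "\<And>k. 0 < k \<Longrightarrow> k < 4 * n * N \<Longrightarrow> \<zeta> ^ k \<noteq> 1"
    using assms(5) by (auto simp: primitive_root_of_unity_def)
  show ?thesis
  proof (rule not_self_dual)
    \<comment> \<open>\<open>\<zeta> ^ (2 * n)\<close> has order exactly \<open>2 * N\<close>,
      because \<open>2 * n * (2 * N) = 4 * n * N\<close>.\<close>
    show "(\<zeta> ^ (2 * n)) ^ (2 * N) = 1"
      using \<zeta>(1) by (simp add: mult.assoc mult.left_commute flip: power_mult)
    have "\<zeta> \<noteq> 0" using \<zeta>(1) assms(1,3) by (intro notI) (simp add: power_0_left)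
    have less: "\<zeta> ^ (2 * n * i) \<noteq> \<zeta> ^ (2 * n * j)" if "i < j" "j < 2 * N" for i j
    proof
      assume eq: "\<zeta> ^ (2 * n * i) = \<zeta> ^ (2 * n * j)"
      have "\<zeta> ^ (2 * n * j) = \<zeta> ^ (2 * n * i) * \<zeta> ^ (2 * n * (j - i))"
        using that by (simp flip: power_add distrib_left)
      then have "\<zeta> ^ (2 * n * (j - i)) = 1" using eq \<open>\<zeta> \<noteq> 0\<close> by simp
      moreover have "0 < 2 * n * (j - i)" using that assms(3) by simp
      moreover have "2 * n * (j - i) < 2 * n * (2 * N)"
        using that assms(3) by (intro mult_strict_left_mono) auto
      ultimately show False using \<zeta>(2)[of "2 * n * (j - i)"] by (simp add: mult.assoc mult.left_commute)
    qed
    show "inj_on (\<lambda>i. (\<zeta> ^ (2 * n)) ^ i) {..<2 * N}"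
      by (rule linorder_inj_onI') (use less in \<open>simp flip: power_mult\<close>)
    show "(1 :: 'k) \<noteq> - 1"
    proof
      assume "(1 :: 'k) = - 1"
      \<comment> \<open>Equality of the two signs would make the characteristic divide 2, hence
        \<open>2 * n * N\<close>.\<close>
      then have "(of_nat 2 :: 'k) = 0" by (simp add: eq_neg_iff_add_eq_0)
      then have "CHAR('k) dvd 2" by (simp only: of_nat_eq_0_iff_char_dvd)
      then show False using assms(4) by (metis dvd_mult2 mult.assoc)
    qed
  qed
qed

end
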